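(* Let $n$ be a positive integer, $m$ a non-negative integer, $S\subseteq\mathbb{Z}^2$ a finite set and $f:S\to\mathbb{C}$ a function. Then, as functions of $(k_1,\ldots,k_n)$, $$\alpha_{P,Q}(n,m,S,f;k_1,\ldots,k_n)=P^{\frac16(n-1)(n^2-2n+6m)}Q^{-\binom n2}\prod_{1\le s<t\le n}\Big({}_P^QE_{k_t}\,{}_P^Q\mathrm{id}_{k_s}-{}_P\Delta_{k_s}\,{}_P\Delta_{k_t}\sum_{(i,j)\in S}f(i,j)\,{}_PE_{k_t}^{\,i}\,{}_PE_{k_s}^{\,j}\Big)\det_{1\le i,j\le n}\binom{k_i}{j-1+\delta_{j,n}m}_P .$$ For $m=0$ this simplifies to $$\alpha_{P,Q}(n,0,S,f;k_1,\ldots,k_n)=P^{\binom{n+1}{3}}Q^{-\binom n2}\prod_{1\le s<t\le n}\Big({}_P^QE_{k_t}\,{}_P^Q\mathrm{id}_{k_s}-{}_P\Delta_{k_s}\,{}_P\Delta_{k_t}\sum_{(i,j)\in S}f(i,j)\,{}_PE_{k_t}^{\,i}\,{}_PE_{k_s}^{\,j}\Big)\prod_{1\le i<j\le n}\frac{P^{k_j}-P^{k_i}}{P^j-P^i}.$$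
   Context: $P,Q$ are indeterminates. Operators act on functions of integer variables: $E_xp(x)=p(x+1)$, $\Delta_x=E_x-\mathrm{id}$, ${}_P\Delta_x=P^{-x}\Delta_x$, ${}_PE_x={}_P\Delta_x+\mathrm{id}$, ${}_P^QE_x=Q\,\mathrm{id}+{}_P\Delta_x$, ${}_P^Q\mathrm{id}_x=Q\,{}_PE_x-{}_P\Delta_x$. Products of operators are compositions; operators in different variables commute. For $i<0$, ${}_PE_x^{\,i}:=\big(\sum_{j\ge0}(-1)^j{}_P\Delta_x^j\big)^{-i}$, applied only to functions annihilated by some power of ${}_P\Delta_x$ (so the sum is finite). The $P$-binomial coefficient is $\binom{x}{m}_P=\frac{(1-P^x)(1-P^{x-1})\cdots(1-P^{x-m+1})}{(1-P^m)(1-P^{m-1})\cdots(1-P)}$. Convention: $\sum_{x=a}^b g(x):=-\sum_{x=b+1}^{a-1}g(x)$ if $a>b$. $\delta_{j,n}$ is the Kronecker delta. Summation operator (depending on $S,f$): for a tuple $(k_1,\ldots,k_n)$ and a function $A$ of $n-1$ integer variables, define $\sum_{(l_1,\ldots,l_{n-1})}^{(k_1,\ldots,k_n)}A(l_1,\ldots,l_{n-1})$ recursively: for $n=0$ it is $0$; for $n=1$ it is $A$; for $n\ge2$ it equals $$\Big(Q^{-1}\,{}_P^QE_{k_n}\,{}_P^Q\mathrm{id}_{k^*_{n-1}}\sum_{l_{n-1}=k^*_{n-1}}^{k_n-1}P^{l_{n-1}}\sum_{(l_1,\ldots,l_{n-2})}^{(k_1,\ldots,k_{n-1})}A(l_1,\ldots,l_{n-1})+\sum_{(l_1,\ldots,l_{n-3})}^{(k_1,\ldots,k_{n-2})}\sum_{(i,j)\in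 S}f(i,j)\,{}_PE_{k_{n-1}}^{\,i}\,{}_PE_{k^*_{n-1}}^{\,j}A(l_1,\ldots,l_{n-3},k_{n-1},k^*_{n-1})\Big)\Big|_{k^*_{n-1}=k_{n-1}},$$ where $k^*_{n-1}$ is an auxiliary variable, the operators are applied to the expression as a function of $k_1,\ldots,k_n,k^*_{n-1}$, and then $k^*_{n-1}$ is set equal to $k_{n-1}$ (inner summation operators act on the variables $l$ only, the remaining arguments being carried along). Define $\alpha_{P,Q}(1,m,S,f;k_1)=\binom{k_1}{m}_P$ and for $n\ge2$, $\alpha_{P,Q}(n,m,S,f;k_1,\ldots,k_n)=\sum_{(l_1,\ldots,l_{n-1})}^{(k_1,\ldots,k_n)}\alpha_{P,Q}(n-1,m,S,f;l_1,\ldots,l_{n-1})$. (Each $\alpha_{P,Q}$ is a $\mathbb{C}[P^{\pm1},Q^{\pm1}]$-linear combination of products $\prod_j\binom{k_j}{r_j}_P$, so negative powers of ${}_PE$ are well defined on it.) *)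

theory Defs
  imports
    "HOL-Computational_Algebra.Computational_Algebra"
    "Jordan_Normal_Form.Determinant"
begin

(* The coefficient domain is the field C(P,Q), realised as the fraction field of C[P][Q]; it
   contains C[P,1/P,Q,1/Q] and the quotients that occur in P-binomial coefficients. *)
type_synonym ratPQ = "complex poly poly fract"

definition const :: "complex \<Rightarrow> ratPQ" where
  "const c = to_fract [:[:c:]:]"

definition indP :: ratPQ where
  "indP = to_fract [:[:0, 1:]:]"

definition indQ :: ratPQ where
  "indQ = to_fract [:0, 1:]"

type_synonym fun1 = "int \<Rightarrow> ratPQ"

definition op_Delta :: "fun1 \<Rightarrow> fun1" where
  "op_Delta p = (\<lambda>x. indP powi (- x) * (p (x + 1) - p x))"

definition op_E :: "fun1 \<Rightarrow> fun1" where
  "op_E p = (\<lambda>x. op_Delta p x + p x)"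

definition op_QE :: "fun1 \<Rightarrow> fun1" where
  "op_QE p = (\<lambda>x. indQ * p x + op_Delta p x)"

definition op_Qid :: "fun1 \<Rightarrow> fun1" where
  "op_Qid p = (\<lambda>x. indQ * op_E p x - op_Delta p x)"

(* Neumann series for the inverse of op_E.  Only the nonvanishing iterates are summed, so this is
   the intended finite sum whenever p is annihilated by some power of op_Delta; the operator is
   not meant to be used on other functions (there the index set is infinite and the value is 0). *)
definition op_E_inv :: "fun1 \<Rightarrow> fun1" where
  "op_E_inv p = (\<lambda>x. \<Sum>j | (op_Delta ^^ j) p \<noteq> (\<lambda>_. 0). (- 1) ^ j * (op_Delta ^^ j) p x)"

definition op_E_pow :: "int \<Rightarrow> fun1 \<Rightarrow> fun1" where
  "op_E_pow i = (if i \<ge> 0 then op_E ^^ nat i else op_E_inv ^^ nat (- i))"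

definition qbinom :: "int \<Rightarrow> nat \<Rightarrow> ratPQ" where
  "qbinom x m = (\<Prod>i<m. 1 - indP powi (x - int i)) / (\<Prod>i=1..m. 1 - indP ^ i)"

definition esum :: "int \<Rightarrow> int \<Rightarrow> (int \<Rightarrow> ratPQ) \<Rightarrow> ratPQ" where
  "esum a b g = (if a \<le> b then \<Sum>x\<in>{a..b}. g x else - (\<Sum>x\<in>{b + 1..a - 1}. g x))"

(* A function of n integer variables is a function on lists of length n; the variable k_i is the
   list entry with index i - 1.

   summation S f n A ks is the summation operator for the tuple formed by the first n entries
   of ks, applied to a function A of n - 1 variables.  In the recursive case k_n = ks ! Suc n and
   k_(n-1) = ks ! n.  The auxiliary variable k*_(n-1) is the inner bound variable y, and applying
   the operator in y at the point ks ! n is the final substitution k*_(n-1) = k_(n-1). *)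
fun summation ::
  "(int \<times> int) set \<Rightarrow> (int \<times> int \<Rightarrow> complex) \<Rightarrow> nat \<Rightarrow> (int list \<Rightarrow> ratPQ) \<Rightarrow> int list \<Rightarrow> ratPQ"
where
  "summation S f 0 A ks = 0"
| "summation S f (Suc 0) A ks = A []"
| "summation S f (Suc (Suc n)) A ks =
     inverse indQ *
       op_QE (\<lambda>x. op_Qid (\<lambda>y.
           esum y (x - 1) (\<lambda>l. indP powi l * summation S f (Suc n) (\<lambda>ls. A (ls @ [l])) ks))
         (ks ! n)) (ks ! Suc n)
     + summation S f n
         (\<lambda>ls. \<Sum>(i, j)\<in>S. const (f (i, j)) *
            op_E_pow i (\<lambda>x. op_E_pow j (\<lambda>y. A (ls @ [x, y])) (ks ! n)) (ks ! n))
         ks"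

(* The first equation is a dummy value; the family starts at n = 1. *)
fun alpha ::
  "nat \<Rightarrow> nat \<Rightarrow> (int \<times> int) set \<Rightarrow> (int \<times> int \<Rightarrow> complex) \<Rightarrow> int list \<Rightarrow> ratPQ"
where
  "alpha 0 m S f ks = 0"
| "alpha (Suc 0) m S f ks = qbinom (ks ! 0) m"
| "alpha (Suc (Suc n)) m S f ks = summation S f (Suc (Suc n)) (alpha (Suc n) m S f) ks"

definition on_var :: "nat \<Rightarrow> (fun1 \<Rightarrow> fun1) \<Rightarrow> (int list \<Rightarrow> ratPQ) \<Rightarrow> int list \<Rightarrow> ratPQ" where
  "on_var i T F ks = T (\<lambda>x. F (ks[i := x])) (ks ! i)"

definition pair_op ::
  "(int \<times> int) set \<Rightarrow> (int \<times> int \<Rightarrow> complex) \<Rightarrow> nat \<Rightarrow> nat \<Rightarrow> (int list \<Rightarrow> ratPQ) \<Rightarrow> int list \<Rightarrow> ratPQ"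
where
  "pair_op S f s t F = (\<lambda>ks.
     on_var t op_QE (on_var s op_Qid F) ks
     - on_var s op_Delta (on_var t op_Delta
         (\<lambda>ls. \<Sum>(i, j)\<in>S. const (f (i, j)) * on_var t (op_E_pow i) (on_var s (op_E_pow j) F) ls)) ks)"

(* The composition over all pairs s < t < n.  On the functions considered the factors commute,
   so the order chosen here is immaterial. *)
definition prod_op ::
  "(int \<times> int) set \<Rightarrow> (int \<times> int \<Rightarrow> complex) \<Rightarrow> nat \<Rightarrow> (int list \<Rightarrow> ratPQ) \<Rightarrow> int list \<Rightarrow> ratPQ"
where
  "prod_op S f n = foldr (\<lambda>(s, t) G. pair_op S f s t \<circ> G) [(s, t). t \<leftarrow> [0..<n], s \<leftarrow> [0..<t]] id"

definition binom_det :: "nat \<Rightarrow> nat \<Rightarrow> int list \<Rightarrow> ratPQ" where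
  "binom_det n m ks = det (mat n n (\<lambda>(i, j). qbinom (ks ! i) (j + (if Suc j = n then m else 0))))"

(* The shift by one in the denominator comes from the 0-based indices. *)
definition vandermonde_quot :: "nat \<Rightarrow> int list \<Rightarrow> ratPQ" where
  "vandermonde_quot n ks =
     (\<Prod>j<n. \<Prod>i<j. (indP powi (ks ! j) - indP powi (ks ! i)) / (indP ^ Suc j - indP ^ Suc i))"

(* The exponent of P in the general formula is an integer, so writing it with div is exact. *)
lemma exponent_dvd: "6 dvd (int n - 1) * (int n ^ 2 - 2 * int n + 6 * int m)"
proof (induction n)
  case 0
  then show ?case by simp
next
  case (Suc n)
  have "even (int n * (int n - 1))"
    by simp
  then obtain c where c: "int n * (int n - 1) = 2 * c" ..
  have "(int (Suc n) - 1) * (int (Suc n) ^ 2 - 2 * int (Suc n) + 6 * int m)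
      = (int n - 1) * (int n ^ 2 - 2 * int n + 6 * int m) + 3 * (int n * (int n - 1)) + 6 * int m"
    by (simp add: algebra_simps power2_eq_square)
  then have "(int (Suc n) - 1) * (int (Suc n) ^ 2 - 2 * int (Suc n) + 6 * int m)
      = (int n - 1) * (int n ^ 2 - 2 * int n + 6 * int m) + 6 * (c + int m)"
    using c by simp
  then show ?case
    using Suc.IH by (metis dvd_add dvd_triv_left)
qed

end

theory Submission
  imports Defs "HOL-Combinatorics.Transposition"
begin

text \<open>
  Every operator in sight is a polynomial in the commuting operators \<open>D\<^sub>i\<close> (\<open>P\<close>-difference in \<open>k\<^sub>i\<close>), because
  the \<open>D\<^sub>i\<close> are nilpotent on the functions concerned. Write the factor for \<open>s < t\<close> as \<open>W(D\<^sub>s, D\<^sub>t)\<close>.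
  Suppose that \<open>W(D\<^sub>i\<^sub>+\<^sub>1, D\<^sub>i) C\<close> vanishes on \<open>k\<^sub>i = k\<^sub>i\<^sub>+\<^sub>1\<close> for every \<open>i\<close>. Then the sum operator telescopes
  on \<open>D\<^sub>1 \<dots> D\<^sub>n\<^sub>-\<^sub>1 C\<close>: what the second summand of the recursion contributes is exactly what is needed to cancel the
  unwanted boundary terms, and there remains the alternating sum over \<open>r\<close> of
  \<open>\<Prod>\<^sub>s\<^sub><\<^sub>r Qid\<^sub>s \<Prod>\<^sub>t\<^sub>>\<^sub>r QE\<^sub>t C\<close> with \<open>k\<^sub>r\<close> omitted. Since \<open>W(D\<^sub>s, 0) = Q Qid\<^sub>s\<close> and \<open>W(0, D\<^sub>t) = Q QE\<^sub>t\<close>,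
  for \<open>C = \<Prod> W B\<close> each such term is \<open>Q\<^sup>1\<^sup>-\<^sup>n \<Prod> W\<close> applied to \<open>B\<close> with \<open>k\<^sub>r\<close> omitted, and if \<open>B\<close> is the minor
  of the binomial determinant without its constant first column, the alternating sum is the Laplace
  expansion along that column. The vanishing condition holds because
  \<open>W(D\<^sub>i\<^sub>+\<^sub>1, D\<^sub>i) \<Prod> W\<close> is symmetric in \<open>k\<^sub>i, k\<^sub>i\<^sub>+\<^sub>1\<close> and \<open>B\<close> is antisymmetric.
\<close>

section \<open>Algebras of commuting operators\<close>

definition linear_op :: "(('a \<Rightarrow> 'k::comm_ring_1) \<Rightarrow> 'b \<Rightarrow> 'k) \<Rightarrow> bool" where
  "linear_op T \<longleftrightarrow> (\<forall>F G. T (\<lambda>x. F x + G x) = (\<lambda>x. T F x + T G x))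
                \<and> (\<forall>c F. T (\<lambda>x. c * F x) = (\<lambda>x. c * T F x))"

lemma linear_op_add: "linear_op T \<Longrightarrow> T (\<lambda>x. F x + G x) = (\<lambda>x. T F x + T G x)"
  by (auto simp: linear_op_def)

lemma linear_op_scale: "linear_op T \<Longrightarrow> T (\<lambda>x. c * F x) = (\<lambda>x. c * T F x)"
  by (auto simp: linear_op_def)

lemma linear_op_zero: "linear_op T \<Longrightarrow> T (\<lambda>_. 0) = (\<lambda>_. 0)"
  using linear_op_scale[of T 0 "\<lambda>_. 0"] by simp

lemma linear_op_diff: "linear_op T \<Longrightarrow> T (\<lambda>x. F x - G x) = (\<lambda>x. T F x - T G x)"
  using linear_op_add[of T F "\<lambda>x. (-1) * G x"] linear_op_scale[of T "-1" G] by (simp add: fun_eq_iff)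

lemma linear_op_sum: "linear_op T \<Longrightarrow> T (\<lambda>x. \<Sum>i\<in>I. F i x) = (\<lambda>x. \<Sum>i\<in>I. T (F i) x)"
proof (induction I rule: infinite_finite_induct)
  case (insert i I)
  then show ?case using linear_op_add[OF insert.prems, of "F i" "\<lambda>x. \<Sum>i\<in>I. F i x"] by simp
qed (simp_all add: linear_op_zero)

text \<open>Membership is generated inductively rather than read off from polynomials, so linearity,
  commutation and dependence on lists of one fixed length are checked on generators and follow by
  induction for everything built from them.\<close>

inductive_set op_algebra ::
  "(('a \<Rightarrow> 'k::comm_ring_1) \<Rightarrow> 'a \<Rightarrow> 'k) set \<Rightarrow> (('a \<Rightarrow> 'k) \<Rightarrow> 'a \<Rightarrow> 'k) set"
  for G where
  id: "(\<lambda>F. F) \<in> op_algebra G"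
| gen: "T \<in> G \<Longrightarrow> T \<in> op_algebra G"
| scale: "T \<in> op_algebra G \<Longrightarrow> (\<lambda>F x. c * T F x) \<in> op_algebra G"
| add: "T \<in> op_algebra G \<Longrightarrow> U \<in> op_algebra G \<Longrightarrow> (\<lambda>F x. T F x + U F x) \<in> op_algebra G"
| comp: "T \<in> op_algebra G \<Longrightarrow> U \<in> op_algebra G \<Longrightarrow> (\<lambda>F. T (U F)) \<in> op_algebra G"

lemma op_algebra_mono: "T \<in> op_algebra G \<Longrightarrow> G \<subseteq> H \<Longrightarrow> T \<in> op_algebra H"
  by (induction rule: op_algebra.induct) (auto intro: op_algebra.intros)

lemma op_algebra_diff:
  assumes "T \<in> op_algebra G" "U \<in> op_algebra G"
  shows "(\<lambda>F x. T F x - U F x) \<in> op_algebra G"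
  using op_algebra.add[OF assms(1) op_algebra.scale[OF assms(2), of "-1"]] by simp

lemma op_algebra_sum:
  assumes "\<And>i. i \<in> I \<Longrightarrow> T i \<in> op_algebra G"
  shows "(\<lambda>F x. \<Sum>i\<in>I. T i F x) \<in> op_algebra G"
  using assms
proof (induction I rule: infinite_finite_induct)
  case (insert i I)
  then show ?case by (simp add: op_algebra.add)
qed (use op_algebra.scale[OF op_algebra.id, of 0 G] in simp_all)

lemma op_algebra_funpow: "T \<in> op_algebra G \<Longrightarrow> T ^^ n \<in> op_algebra G"
proof (induction n)
  case 0
  show ?case using op_algebra.id by (simp add: id_def)
next
  case (Suc n)
  then show ?case using op_algebra.comp[of T G "T ^^ n"] by (simp add: comp_def)
qed

lemma op_algebra_foldr:
  assumes "\<And>x. x \<in> set xs \<Longrightarrow> T x \<in> op_algebra G"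
  shows "foldr T xs \<in> op_algebra G"
  using assms
proof (induction xs)
  case Nil
  show ?case using op_algebra.id by (simp add: id_def)
next
  case (Cons x xs)
  then show ?case using op_algebra.comp[of "T x" G "foldr T xs"] by (simp add: comp_def)
qed

lemma op_algebra_linear:
  assumes "T \<in> op_algebra G" "\<And>U. U \<in> G \<Longrightarrow> linear_op U"
  shows "linear_op T"
  using assms by (induction rule: op_algebra.induct) (auto simp: linear_op_def algebra_simps)

text \<open>Linearity of \<open>U\<close> carries commutation through sums and scalar multiples.
  Applied once to each of two operators, this yields commutativity of the whole algebra.\<close>

lemma op_algebra_commute_gen:
  assumes "T \<in> op_algebra G" "linear_op U" "\<And>V F. V \<in> G \<Longrightarrow> V (U F) = U (V F)"
  shows "T (U F) = U (T F)"
  using assms(1)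
proof (induction arbitrary: F rule: op_algebra.induct)
  case (scale T c)
  then show ?case by (simp add: linear_op_scale[OF assms(2)])
next
  case (add T V)
  then show ?case by (simp add: linear_op_add[OF assms(2)])
qed (use assms in auto)

lemma op_algebra_commute:
  assumes "T \<in> op_algebra G" "U \<in> op_algebra G" "\<And>V. V \<in> G \<Longrightarrow> linear_op V"
    and "\<And>V W F. V \<in> G \<Longrightarrow> W \<in> G \<Longrightarrow> V (W F) = W (V F)"
  shows "T (U F) = U (T F)"
proof (rule op_algebra_commute_gen[OF assms(1)])
  show "linear_op U" using assms op_algebra_linear by blast
  show "V (U F) = U (V F)" if "V \<in> G" for V F
    using op_algebra_commute_gen[OF assms(2), of V F] assms that by metis
qed

section \<open>Operators in one variable\<close>

lemma linear_op_Delta: "linear_op op_Delta"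
  by (simp add: linear_op_def op_Delta_def fun_eq_iff algebra_simps)

abbreviation delta_ops :: "(fun1 \<Rightarrow> fun1) set" where
  "delta_ops \<equiv> op_algebra {op_Delta}"

lemma linear_delta_ops: "T \<in> delta_ops \<Longrightarrow> linear_op T"
  using op_algebra_linear linear_op_Delta by blast

text \<open>An operator in \<open>x\<close>, evaluated at \<open>l\<close>, is a finite combination
  of the functions \<open>H x\<close> with scalar coefficients, and a linear \<open>L\<close>
  respects such combinations. One-variable operators can thus pass through whatever acts linearly on
  the other arguments.\<close>

lemma delta_ops_exchange:
  assumes "T \<in> delta_ops" "linear_op L"
  shows "L (\<lambda>ls. T (\<lambda>x. H x ls) l) = (\<lambda>y. T (\<lambda>x. L (H x) y) l)"
  using assms(1)
proof (induction arbitrary: H l rule: op_algebra.induct)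
  case (gen T)
  have "L (\<lambda>ls. indP powi (- l) * (H (l + 1) ls - H l ls))
      = (\<lambda>y. indP powi (- l) * (L (H (l+1)) y - L (H l) y))"
    by (simp add: linear_op_scale[OF assms(2)] linear_op_diff[OF assms(2)])
  then show ?case using gen by (simp add: op_Delta_def)
next
  case (scale T c)
  then show ?case by (simp add: linear_op_scale[OF assms(2)])
next
  case (add T V)
  then show ?case by (simp add: linear_op_add[OF assms(2)])
next
  case (comp T U)
  show ?case
    using comp.IH(1)[of "\<lambda>x ls. U (\<lambda>x. H x ls) x" l] comp.IH(2)[of H] by simp
qed simp

lemma op_E_delta: "op_E \<in> delta_ops"
  unfolding op_E_def[abs_def] by (rule op_algebra.add[OF op_algebra.gen op_algebra.id]) simp

lemma op_QE_delta: "op_QE \<in> delta_ops"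
  unfolding op_QE_def[abs_def] by (rule op_algebra.add[OF op_algebra.scale[OF op_algebra.id] op_algebra.gen]) simp

lemma op_Qid_delta: "op_Qid \<in> delta_ops"
  unfolding op_Qid_def[abs_def] by (rule op_algebra_diff[OF op_algebra.scale[OF op_E_delta] op_algebra.gen]) simp

text \<open>
  The operator \<open>op_E_inv\<close> is not linear: its value is \<open>0\<close> on functions that are not nilpotent. Fixing the
  truncation order \<open>N\<close> in advance gives a linear operator that agrees with it where \<open>D\<^sup>N\<close> vanishes.
\<close>

definition trunc_E_inv :: "nat \<Rightarrow> fun1 \<Rightarrow> fun1" where
  "trunc_E_inv N p = (\<lambda>x. \<Sum>j<N. (- 1) ^ j * (op_Delta ^^ j) p x)"

definition trunc_E_pow :: "nat \<Rightarrow> int \<Rightarrow> fun1 \<Rightarrow> fun1" where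
  "trunc_E_pow N i = (if i \<ge> 0 then op_E ^^ nat i else trunc_E_inv N ^^ nat (- i))"

lemma trunc_E_inv_delta: "trunc_E_inv N \<in> delta_ops"
  unfolding trunc_E_inv_def[abs_def]
  by (intro op_algebra_sum op_algebra.scale op_algebra_funpow op_algebra.gen) auto

lemma trunc_E_pow_delta: "trunc_E_pow N i \<in> delta_ops"
  unfolding trunc_E_pow_def using op_E_delta trunc_E_inv_delta by (auto intro: op_algebra_funpow)

lemma delta_ops_commute: "T \<in> delta_ops \<Longrightarrow> U \<in> delta_ops \<Longrightarrow> T (U p) = U (T p)"
  by (rule op_algebra_commute[of T "{op_Delta}" U]) (auto simp: linear_op_Delta)

lemma delta_ops_nilpotent:
  assumes "T \<in> delta_ops" "(op_Delta ^^ N) p = (\<lambda>_. 0)"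
  shows "(op_Delta ^^ N) (T p) = (\<lambda>_. 0)"
proof -
  have "op_Delta ^^ N \<in> delta_ops" by (intro op_algebra_funpow op_algebra.gen) auto
  then show ?thesis
    using delta_ops_commute assms linear_op_zero[OF linear_delta_ops[OF assms(1)]] by metis
qed

lemma op_Delta_funpow_zero_mono:
  assumes "(op_Delta ^^ N) p = (\<lambda>_. 0)" "N \<le> M"
  shows "(op_Delta ^^ M) p = (\<lambda>_. 0)"
  using assms(2)
proof (induction rule: dec_induct)
  case (step M)
  then show ?case by (simp add: linear_op_zero[OF linear_op_Delta])
qed (rule assms(1))

lemma op_E_inv_eq_trunc:
  assumes "(op_Delta ^^ N) p = (\<lambda>_. 0)"
  shows "op_E_inv p = trunc_E_inv N p"
proof -
  have *: "{j. (op_Delta ^^ j) p \<noteq> (\<lambda>_. 0)} \<subseteq> {..<N}"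
    using op_Delta_funpow_zero_mono[OF assms] by (auto simp: not_le[symmetric])
  show ?thesis unfolding op_E_inv_def trunc_E_inv_def
    by (intro ext sum.mono_neutral_left * finite_lessThan) auto
qed

lemma op_E_pow_eq_trunc:
  assumes "(op_Delta ^^ N) p = (\<lambda>_. 0)"
  shows "op_E_pow i p = trunc_E_pow N i p"
proof -
  have "(op_E_inv ^^ k) p = (trunc_E_inv N ^^ k) p" for k
  proof (induction k)
    case (Suc k)
    have "(op_Delta ^^ N) ((trunc_E_inv N ^^ k) p) = (\<lambda>_. 0)"
      using delta_ops_nilpotent[OF op_algebra_funpow[OF trunc_E_inv_delta] assms] .
    then show ?case using Suc op_E_inv_eq_trunc by simp
  qed simp
  then show ?thesis by (simp add: op_E_pow_def trunc_E_pow_def)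
qed

text \<open>Needed for positions beyond the end of a list: \<open>list_update\<close> then does
  nothing, so the operator sees a constant function.\<close>

lemma delta_ops_const:
  assumes "T \<in> delta_ops"
  shows "\<exists>d. T (\<lambda>_. c) = (\<lambda>_. d)"
  using assms
proof (induction arbitrary: c rule: op_algebra.induct)
  case (scale T a)
  obtain d where "T (\<lambda>_. c) = (\<lambda>_. d)" using scale.IH by blast
  then show ?case by auto
next
  case (add T U)
  obtain d e where "T (\<lambda>_. c) = (\<lambda>_. d)" "U (\<lambda>_. c) = (\<lambda>_. e)" using add.IH by blast
  then show ?case by auto
next
  case (comp T U)
  then show ?case by metis
qed (auto simp: op_Delta_def)

lemma on_var_comp:
  assumes "T \<in> delta_ops" "U \<in> delta_ops"
  shows "on_var s (\<lambda>p. T (U p)) F = on_var s T (on_var s U F)"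
proof
  fix ks
  show "on_var s (\<lambda>p. T (U p)) F ks = on_var s T (on_var s U F) ks"
  proof (cases "s < length ks")
    case True
    then show ?thesis by (simp add: on_var_def)
  next
    case False
    then have [simp]: "ks[s := x] = ks" for x by (simp add: list_update_beyond)
    obtain d where d: "U (\<lambda>_. F ks) = (\<lambda>_. d)" using delta_ops_const[OF assms(2)] by blast
    then show ?thesis by (simp add: on_var_def)
  qed
qed

section \<open>Operators on functions of several variables\<close>

abbreviation Dv :: "nat \<Rightarrow> (int list \<Rightarrow> ratPQ) \<Rightarrow> int list \<Rightarrow> ratPQ" where
  "Dv s \<equiv> on_var s op_Delta"

abbreviation var_ops :: "nat set \<Rightarrow> ((int list \<Rightarrow> ratPQ) \<Rightarrow> int list \<Rightarrow> ratPQ) set" where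
  "var_ops A \<equiv> op_algebra (Dv ` A)"

lemma Dv_eq: "Dv s F ks = indP powi (- (ks ! s)) * (F (ks[s := ks ! s + 1]) - F ks)"
  by (simp add: on_var_def op_Delta_def)

lemma linear_Dv: "linear_op (Dv s)"
  by (simp add: linear_op_def fun_eq_iff Dv_eq algebra_simps)

lemma Dv_out_of_range: "length ks \<le> s \<Longrightarrow> Dv s F ks = 0"
  by (simp add: Dv_eq list_update_beyond)

lemma Dv_commute: "Dv s (Dv t F) = Dv t (Dv s F)"
proof
  fix ks :: "int list"
  show "Dv s (Dv t F) ks = Dv t (Dv s F) ks"
  proof (cases "s = t \<or> s \<ge> length ks \<or> t \<ge> length ks")
    case True
    moreover have "Dv s (Dv t F) ks = 0" if "length ks \<le> t" for s t
      using that by (simp add: Dv_eq[of s "Dv t F"] Dv_out_of_range)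
    ultimately show ?thesis by (auto simp: Dv_out_of_range)
  next
    case False
    then show ?thesis by (simp add: Dv_eq list_update_swap algebra_simps)
  qed
qed

lemma linear_var_ops: "T \<in> var_ops A \<Longrightarrow> linear_op T"
  by (rule op_algebra_linear[of T "Dv ` A"]) (auto simp: linear_Dv)

lemma var_ops_mono: "T \<in> var_ops A \<Longrightarrow> A \<subseteq> B \<Longrightarrow> T \<in> var_ops B"
  by (erule op_algebra_mono) auto

lemma var_ops_commute:
  assumes "T \<in> var_ops A" "U \<in> var_ops B"
  shows "T (U F) = U (T F)"
  by (rule op_algebra_commute[of T "Dv ` UNIV" U])
     (use assms in \<open>auto simp: linear_Dv Dv_commute intro: var_ops_mono\<close>)

lemma on_var_id: "on_var s (\<lambda>p. p) F = F"
  by (simp add: on_var_def fun_eq_iff)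

lemma on_var_var_ops:
  assumes "T \<in> delta_ops" "s \<in> A"
  shows "on_var s T \<in> var_ops A"
  using assms(1)
proof (induction rule: op_algebra.induct)
  case id
  have "on_var s (\<lambda>p. p) = (\<lambda>F. F)" by (simp add: on_var_id fun_eq_iff)
  then show ?case by (simp add: op_algebra.id)
next
  case (gen T)
  then show ?case using assms(2) by (auto intro: op_algebra.gen)
next
  case (scale T c)
  then show ?case using op_algebra.scale[of "on_var s T" _ c] by (simp add: on_var_def[abs_def])
next
  case (add T U)
  then show ?case using op_algebra.add[of "on_var s T" _ "on_var s U"] by (simp add: on_var_def[abs_def])
next
  case (comp T U)
  have "on_var s (\<lambda>p. T (U p)) = (\<lambda>F. on_var s T (on_var s U F))"
    using on_var_comp[OF comp.hyps] by (simp add: fun_eq_iff)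
  then show ?case using comp op_algebra.comp by metis
qed

text \<open>Shifting an entry preserves the length of a list, so identities known only for lists of
  length \<open>n\<close> may be used under these operators.\<close>

lemma var_ops_cong:
  assumes "T \<in> var_ops A" "\<And>ls. length ls = n \<Longrightarrow> F ls = G ls" "length ls = n"
  shows "T F ls = T G ls"
  using assms
proof (induction arbitrary: F G ls rule: op_algebra.induct)
  case (gen T)
  then show ?case by (auto simp: Dv_eq)
next
  case (scale T c)
  then show ?case by (metis (no_types, lifting))
next
  case (add T U)
  have "T F ls = T G ls" "U F ls = U G ls" using add.IH[of F G] add.prems by blast+
  then show ?case by simp
next
  case (comp T U)
  have "U F ks = U G ks" if "length ks = n" for ks using comp.IH(2)[of F G] comp.prems that by blast
  then show ?case using comp.IH(1) comp.prems(2) by blast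
qed blast

text \<open>Operators at positions below \<open>n\<close> never touch the tail \<open>vs\<close>.
  The composition case goes through \<open>var_ops_cong\<close>, since its induction hypothesis
  speaks of lists of length \<open>n\<close> only.\<close>

lemma var_ops_append:
  assumes "T \<in> var_ops {..<n}" "length ls = n"
  shows "T (\<lambda>ls. F (ls @ vs)) ls = T F (ls @ vs)"
proof -
  have "\<forall>ls. length ls = n \<longrightarrow> T (\<lambda>ls. F (ls @ vs)) ls = T F (ls @ vs)"
    using assms(1)
  proof (induction arbitrary: F rule: op_algebra.induct)
    case (gen T)
    then show ?case by (auto simp: Dv_eq list_update_append nth_append)
  next
    case (comp T U)
    show ?case
    proof (intro allI impI)
      fix ls :: "int list" assume ls: "length ls = n"
      have "T (U (\<lambda>ls. F (ls @ vs))) ls = T (\<lambda>ls. U F (ls @ vs)) ls"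
        by (rule var_ops_cong[OF comp.hyps(1) _ ls]) (use comp.IH(2) in blast)
      also have "\<dots> = T (U F) (ls @ vs)" using comp.IH(1)[of "U F"] ls by blast
      finally show "T (U (\<lambda>ls. F (ls @ vs))) ls = T (U F) (ls @ vs)" .
    qed
  qed auto
  then show ?thesis using assms(2) by blast
qed

lemma on_var_append:
  assumes "length us = s"
  shows "on_var s T F (us @ x # vs) = T (\<lambda>x. F (us @ x # vs)) x"
  using assms by (auto simp: on_var_def list_update_append)

text \<open>A copy of \<open>pair_op\<close> that lies in the operator algebra, hence is linear and
  commutes with the other factors; \<open>prod_op_eq_trunc\<close> returns to the original
  operators.\<close>

definition trunc_pair_op ::
  "(int \<times> int) set \<Rightarrow> (int \<times> int \<Rightarrow> complex) \<Rightarrow> nat \<Rightarrow> nat \<Rightarrow> nat \<Rightarrow> (int list \<Rightarrow> ratPQ) \<Rightarrow> int list \<Rightarrow> ratPQ"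
where
  "trunc_pair_op S f N s t F = (\<lambda>ks.
     on_var t op_QE (on_var s op_Qid F) ks
     - on_var s op_Delta (on_var t op_Delta
         (\<lambda>ls. \<Sum>(i, j)\<in>S. const (f (i, j)) * on_var t (trunc_E_pow N i) (on_var s (trunc_E_pow N j) F) ls)) ks)"

lemma trunc_pair_op_var_ops:
  assumes "s \<in> A" "t \<in> A"
  shows "trunc_pair_op S f N s t \<in> var_ops A"
proof -
  have D: "Dv s \<in> var_ops A" "Dv t \<in> var_ops A" using assms by (auto intro: op_algebra.gen)
  have "(\<lambda>F ls. (case p of (i, j) \<Rightarrow> const (f (i, j)) *
          on_var t (trunc_E_pow N i) (on_var s (trunc_E_pow N j) F) ls)) \<in> var_ops A" for p
  proof (cases p)
    case (Pair i j)
    have "(\<lambda>F. on_var t (trunc_E_pow N i) (on_var s (trunc_E_pow N j) F)) \<in> var_ops A"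
      by (rule op_algebra.comp; rule on_var_var_ops[OF trunc_E_pow_delta]; rule assms)
    from op_algebra.scale[OF this] show ?thesis using Pair by simp
  qed
  then have "(\<lambda>F ls. \<Sum>(i, j)\<in>S. const (f (i, j)) *
          on_var t (trunc_E_pow N i) (on_var s (trunc_E_pow N j) F) ls) \<in> var_ops A"
    by (rule op_algebra_sum)
  from op_algebra.comp[OF D(1) op_algebra.comp[OF D(2) this]] show ?thesis
    unfolding trunc_pair_op_def[abs_def]
    by (rule op_algebra_diff[OF op_algebra.comp[OF on_var_var_ops[OF op_QE_delta assms(2)]
          on_var_var_ops[OF op_Qid_delta assms(1)]]])
qed


lemma on_var_funpow:
  assumes "T \<in> delta_ops"
  shows "on_var s (T ^^ n) = on_var s T ^^ n"
proof (induction n)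
  case 0
  show ?case by (simp add: on_var_id fun_eq_iff id_def)
next
  case (Suc n)
  show ?case using on_var_comp[OF assms op_algebra_funpow[OF assms, of n], of s]
    by (simp add: fun_eq_iff[where f = "on_var s (T ^^ Suc n)"] comp_def Suc)
qed

lemma on_var_append2:
  assumes "length us = s"
  shows "on_var s T (on_var (Suc s) U F) (us @ [x, y]) = T (\<lambda>x. U (\<lambda>y. F (us @ [x, y])) y) x"
proof -
  have "on_var (Suc s) U F (us @ [x, y]) = U (\<lambda>y. F (us @ [x, y])) y" for x
    using on_var_append[of "us @ [x]" "Suc s" U F y "[]"] assms by simp
  then show ?thesis using on_var_append[OF assms, of T "on_var (Suc s) U F" x "[y]"] by simp
qed

text \<open>By commutativity the two differences move innermost, where they vanish on functions
  constant in one variable; the first term takes the order of operators in which the telescoped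
  recursion produces it.\<close>

lemma trunc_pair_op_alt:
  "trunc_pair_op S f N s t F ks = on_var s op_Qid (on_var t op_QE F) ks
     - (\<Sum>(i, j)\<in>S. const (f (i, j)) *
          on_var t (trunc_E_pow N i) (on_var s (trunc_E_pow N j) (Dv t (Dv s F))) ks)"
proof -
  note v = on_var_var_ops[OF _ UNIV_I]
  have D: "op_Delta \<in> delta_ops" by (auto intro: op_algebra.gen)
  have 1: "on_var t op_QE (on_var s op_Qid F) = on_var s op_Qid (on_var t op_QE F)"
    by (rule var_ops_commute[OF v v]) (rule op_QE_delta op_Qid_delta)+
  have 2: "Dv s (Dv t (on_var t (trunc_E_pow N i) (on_var s (trunc_E_pow N j) F)))
        = on_var t (trunc_E_pow N i) (on_var s (trunc_E_pow N j) (Dv t (Dv s F)))" for i j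
    using var_ops_commute[OF v[OF D] v[OF trunc_E_pow_delta]] Dv_commute by metis
  have 3: "Dv s (Dv t (\<lambda>ls. \<Sum>p\<in>S. (case p of (i, j) \<Rightarrow> const (f (i, j)) * H i j ls)))
     = (\<lambda>ls. \<Sum>p\<in>S. (case p of (i, j) \<Rightarrow> const (f (i, j)) * Dv s (Dv t (H i j)) ls))" for H
    by (simp add: linear_op_sum[OF linear_Dv] linear_op_scale[OF linear_Dv] split_beta)
  show ?thesis unfolding trunc_pair_op_def 1 3 2 ..
qed

section \<open>The summation operator\<close>

fun Qid_all :: "nat \<Rightarrow> (int list \<Rightarrow> ratPQ) \<Rightarrow> int list \<Rightarrow> ratPQ" where
  "Qid_all 0 C ks = C []"
| "Qid_all (Suc n) C ks = op_Qid (\<lambda>y. Qid_all n (\<lambda>ls. C (ls @ [y])) ks) (ks ! n)"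

text \<open>The value of the telescoped sum: the term of index \<open>r\<close> omits entry
  \<open>r\<close> and has \<open>op_Qid\<close> before it and \<open>op_QE\<close> after it, as
  \<open>boundary_sum_eq_mixed_op\<close> makes explicit. \<open>C\<close> takes one argument fewer
  than there are entries, and the recursion peels off the last entry as \<open>summation\<close>
  does.\<close>

fun boundary_sum :: "nat \<Rightarrow> (int list \<Rightarrow> ratPQ) \<Rightarrow> int list \<Rightarrow> ratPQ" where
  "boundary_sum 0 C ks = 0"
| "boundary_sum (Suc n) C ks =
     op_QE (\<lambda>x. boundary_sum n (\<lambda>ls. C (ls @ [x])) ks) (ks ! n) + (- 1) ^ n * Qid_all n C ks"

lemma linear_Qid_all: "linear_op (Qid_all n)"
proof (induction n)
  case 0
  show ?case by (simp add: linear_op_def fun_eq_iff)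
next
  case (Suc n)
  note L = linear_delta_ops[OF op_Qid_delta]
  show ?case unfolding linear_op_def fun_eq_iff
    by (simp add: linear_op_add[OF Suc] linear_op_add[OF L] linear_op_scale[OF Suc] linear_op_scale[OF L])
qed

lemma linear_boundary_sum: "linear_op (boundary_sum n)"
proof (induction n)
  case 0
  show ?case by (simp add: linear_op_def fun_eq_iff)
next
  case (Suc n)
  note L = linear_delta_ops[OF op_QE_delta] and M = linear_Qid_all
  show ?case unfolding linear_op_def fun_eq_iff
    by (simp add: linear_op_add[OF Suc] linear_op_add[OF L] linear_op_scale[OF Suc] linear_op_scale[OF L]
        linear_op_add[OF M] linear_op_scale[OF M] algebra_simps)
qed

lemma Qid_all_cong:
  assumes "\<And>ls. length ls = n \<Longrightarrow> F ls = G ls"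
  shows "Qid_all n F ks = Qid_all n G ks"
  using assms
proof (induction n arbitrary: F G)
  case (Suc n)
  have "Qid_all n (\<lambda>ls. F (ls @ [y])) ks = Qid_all n (\<lambda>ls. G (ls @ [y])) ks" for y
    by (rule Suc.IH) (simp add: Suc.prems)
  then show ?case by simp
qed simp

lemma boundary_sum_cong:
  assumes "\<And>ls. Suc (length ls) = n \<Longrightarrow> F ls = G ls"
  shows "boundary_sum n F ks = boundary_sum n G ks"
  using assms
proof (induction n arbitrary: F G)
  case (Suc n)
  have "boundary_sum n (\<lambda>ls. F (ls @ [y])) ks = boundary_sum n (\<lambda>ls. G (ls @ [y])) ks" for y
    by (rule Suc.IH) (simp add: Suc.prems)
  then show ?case using Qid_all_cong[of n F G ks] Suc.prems by simp
qed simp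

lemma summation_cong:
  assumes "\<And>ls. Suc (length ls) = n \<Longrightarrow> F ls = G ls"
  shows "summation S f n F ks = summation S f n G ks"
  using assms
proof (induction n arbitrary: F G rule: induct_nat_012)
  case (ge2 n)
  have 1: "summation S f (Suc n) (\<lambda>ls. F (ls @ [l])) ks = summation S f (Suc n) (\<lambda>ls. G (ls @ [l])) ks" for l
    by (rule ge2.IH) (simp add: ge2.prems)
  have 2: "F (ls @ [x, y]) = G (ls @ [x, y])" if "Suc (length ls) = n" for ls x y
    using ge2.prems that by simp
  have 3: "summation S f n (\<lambda>ls. \<Sum>(i, j)\<in>S. const (f (i, j)) *
            op_E_pow i (\<lambda>x. op_E_pow j (\<lambda>y. F (ls @ [x, y])) (ks ! n)) (ks ! n)) ks
      = summation S f n (\<lambda>ls. \<Sum>(i, j)\<in>S. const (f (i, j)) *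
            op_E_pow i (\<lambda>x. op_E_pow j (\<lambda>y. G (ls @ [x, y])) (ks ! n)) (ks ! n)) ks"
    by (rule ge2.IH) (simp add: 2)
  show ?case by (simp only: summation.simps 1 3)
qed auto

section \<open>Nilpotent and admissible functions\<close>

definition nilpotent_fun :: "nat \<Rightarrow> nat \<Rightarrow> (int list \<Rightarrow> ratPQ) \<Rightarrow> bool" where
  "nilpotent_fun N n C \<longleftrightarrow> (\<forall>ls s. length ls = n \<longrightarrow> s < n \<longrightarrow> (Dv s ^^ N) C ls = 0)"

text \<open>
  The second condition is linear in \<open>C\<close> and inherited when the last variable is fixed, so it survives all
  the manipulations of the recursion except differentiation in the remaining variables; it is therefore
  imposed on the antiderivative \<open>C\<close> and not on the summand.
\<close>

definition admissible ::
  "(int \<times> int) set \<Rightarrow> (int \<times> int \<Rightarrow> complex) \<Rightarrow> nat \<Rightarrow> nat \<Rightarrow> (int list \<Rightarrow> ratPQ) \<Rightarrow> bool"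
where
  "admissible S f N n C \<longleftrightarrow> nilpotent_fun N n C \<and>
     (\<forall>ls i. length ls = n \<longrightarrow> Suc i < n \<longrightarrow> ls ! i = ls ! Suc i \<longrightarrow>
        trunc_pair_op S f N (Suc i) i C ls = 0)"

lemma Dv_funpow_var_ops: "s \<in> A \<Longrightarrow> Dv s ^^ N \<in> var_ops A"
  by (intro op_algebra_funpow op_algebra.gen) auto

lemma linear_Dv_funpow: "linear_op (Dv s ^^ N)"
  using linear_var_ops Dv_funpow_var_ops UNIV_I by blast

lemma linear_trunc_pair_op: "linear_op (trunc_pair_op S f N s t)"
  using linear_var_ops trunc_pair_op_var_ops UNIV_I by blast

lemma admissible_snoc:
  assumes "admissible S f N (Suc n) C"
  shows "admissible S f N n (\<lambda>ls. C (ls @ [x]))"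
proof -
  have "(Dv s ^^ N) (\<lambda>ls. C (ls @ [x])) ls = 0" if "length ls = n" "s < n" for ls s
    using var_ops_append[OF Dv_funpow_var_ops that(1), of s N C "[x]"] that assms
    by (simp add: admissible_def nilpotent_fun_def)
  moreover have "trunc_pair_op S f N (Suc i) i (\<lambda>ls. C (ls @ [x])) ls = 0"
    if "length ls = n" "Suc i < n" "ls ! i = ls ! Suc i" for ls i
    using var_ops_append[OF trunc_pair_op_var_ops that(1), of "Suc i" i S f N C "[x]"] that assms
    by (simp add: admissible_def nth_append)
  ultimately show ?thesis by (auto simp: admissible_def nilpotent_fun_def)
qed

text \<open>The variable \<open>x\<close> is a parameter outside the arguments \<open>ls\<close>, so
  \<open>T\<close> can be exchanged with the linear operators that express both conditions.\<close>

lemma admissible_delta: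
  assumes "T \<in> delta_ops" "\<And>x. admissible S f N n (H x)"
  shows "admissible S f N n (\<lambda>ls. T (\<lambda>x. H x ls) l)"
  using assms(2)
  by (simp add: admissible_def nilpotent_fun_def delta_ops_exchange[OF assms(1) linear_Dv_funpow]
      delta_ops_exchange[OF assms(1) linear_trunc_pair_op] linear_op_zero[OF linear_delta_ops[OF assms(1)]])

lemma admissible_scale: "admissible S f N n C \<Longrightarrow> admissible S f N n (\<lambda>ls. c * C ls)"
  by (simp add: admissible_def nilpotent_fun_def linear_op_scale[OF linear_Dv_funpow]
      linear_op_scale[OF linear_trunc_pair_op])

lemma admissible_sum:
  "(\<And>p. p \<in> I \<Longrightarrow> admissible S f N n (C p)) \<Longrightarrow> admissible S f N n (\<lambda>ls. \<Sum>p\<in>I. C p ls)"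
  by (simp add: admissible_def nilpotent_fun_def linear_op_sum[OF linear_Dv_funpow]
      linear_op_sum[OF linear_trunc_pair_op])

lemma nilpotent_fun_var_ops:
  assumes "nilpotent_fun N n C" "T \<in> var_ops A"
  shows "nilpotent_fun N n (T C)"
proof -
  have "(Dv s ^^ N) (T C) ls = 0" if "length ls = n" "s < n" for ls s
  proof -
    have "(Dv s ^^ N) (T C) ls = T ((Dv s ^^ N) C) ls"
      using var_ops_commute[OF Dv_funpow_var_ops assms(2)] by (metis UNIV_I)
    also have "\<dots> = T (\<lambda>_. 0) ls"
      by (rule var_ops_cong[OF assms(2) _ that(1)]) (use assms(1) that(2) in \<open>auto simp: nilpotent_fun_def\<close>)
    finally show ?thesis by (simp add: linear_op_zero[OF linear_var_ops[OF assms(2)]])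
  qed
  then show ?thesis by (simp add: nilpotent_fun_def)
qed

lemma nilpotent_fun_var:
  assumes "nilpotent_fun N n F" "Suc (length us + length vs) = n"
  shows "(op_Delta ^^ N) (\<lambda>x. F (us @ x # vs)) = (\<lambda>_. 0)"
proof
  fix x
  have "(op_Delta ^^ N) (\<lambda>x. F (us @ x # vs)) x = (Dv (length us) ^^ N) F (us @ x # vs)"
    using on_var_append[OF refl, of us "op_Delta ^^ N" F x vs] on_var_funpow[of op_Delta "length us" N]
    by (simp add: op_algebra.gen)
  then show "(op_Delta ^^ N) (\<lambda>x. F (us @ x # vs)) x = 0"
    using assms by (simp add: nilpotent_fun_def)
qed

text \<open>The inner power is replaced for each fixed \<open>x\<close>. The outer one then needs
  nilpotency in \<open>x\<close> of the result, obtained by exchanging the differences in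
  \<open>x\<close> with the truncated operator in \<open>y\<close>.\<close>

lemma op_E_pow_pair_eq_trunc:
  assumes "nilpotent_fun N (Suc (Suc n)) F" "length ls = n"
  shows "op_E_pow i (\<lambda>x. op_E_pow j (\<lambda>y. F (ls @ [x, y])) k) l
       = trunc_E_pow N i (\<lambda>x. trunc_E_pow N j (\<lambda>y. F (ls @ [x, y])) k) l"
proof -
  have "op_E_pow j (\<lambda>y. F (ls @ [x, y])) = trunc_E_pow N j (\<lambda>y. F (ls @ [x, y]))" for x
    using nilpotent_fun_var[OF assms(1), of "ls @ [x]" "[]"] assms(2) by (simp add: op_E_pow_eq_trunc)
  moreover have "(op_Delta ^^ N) (\<lambda>x. trunc_E_pow N j (\<lambda>y. F (ls @ [x, y])) k) = (\<lambda>_. 0)"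
  proof -
    have "linear_op (op_Delta ^^ N)"
      by (intro linear_delta_ops op_algebra_funpow op_algebra.gen) auto
    then have "(op_Delta ^^ N) (\<lambda>x. trunc_E_pow N j (\<lambda>y. F (ls @ [x, y])) k)
        = (\<lambda>x. trunc_E_pow N j (\<lambda>y. (op_Delta ^^ N) (\<lambda>x. F (ls @ [x, y])) x) k)"
      by (rule delta_ops_exchange[OF trunc_E_pow_delta])
    also have "\<dots> = (\<lambda>_. 0)"
      using nilpotent_fun_var[OF assms(1), of ls "[y]" for y] assms(2)
      by (simp add: linear_op_zero[OF linear_delta_ops[OF trunc_E_pow_delta]])
    finally show ?thesis .
  qed
  ultimately show ?thesis by (simp add: op_E_pow_eq_trunc)
qed

section \<open>Telescoping of the summation operator\<close>

lemma indP_nonzero: "indP \<noteq> 0" by (simp add: indP_def)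

lemma indQ_nonzero: "indQ \<noteq> 0" by (simp add: indQ_def)

text \<open>The weight \<open>indP powi l\<close> cancels the negative power in
  \<open>op_Delta\<close>, and the sign convention for reversed ranges keeps the telescoping valid
  for \<open>y > x\<close>.\<close>

lemma esum_Delta: "esum y (x - 1) (\<lambda>l. indP powi l * op_Delta h l) = h x - h y"
proof -
  have *: "indP powi l * op_Delta h l = h (l + 1) - h l" for l
    using indP_nonzero by (simp add: op_Delta_def power_int_minus)
  have tele: "(\<Sum>l\<in>{a..a + int n - 1}. h (l + 1) - h l) = h (a + int n) - h a" for a n
  proof (induction n)
    case (Suc n)
    have "{a..a + int (Suc n) - 1} = insert (a + int n) {a..a + int n - 1}" by auto
    then show ?case using Suc by (simp add: algebra_simps)
  qed simp
  show ?thesis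
  proof (cases "y \<le> x - 1")
    case True
    then show ?thesis using tele[of y "nat (x - y)"] by (simp add: esum_def *)
  next
    case False
    then show ?thesis using tele[of x "nat (y - x)"] by (simp add: esum_def *)
  qed
qed

text \<open>Both operators multiply constants by \<open>indQ\<close>. Each of the two terms
  therefore keeps one operator and one factor \<open>indQ\<close>, which the inverse
  removes.\<close>

lemma op_QE_Qid_diff:
  "inverse indQ * op_QE (\<lambda>x. op_Qid (\<lambda>y. h x - h y) a) b = op_QE h b - op_Qid h a"
proof -
  have 1: "op_Qid (\<lambda>y. c - h y) a = indQ * c - op_Qid h a" for c
    using linear_op_diff[OF linear_delta_ops[OF op_Qid_delta], of "\<lambda>_. c" h]
    by (simp add: op_Qid_def op_E_def op_Delta_def)
  have 2: "op_QE (\<lambda>x. indQ * h x - d) b = indQ * op_QE h b - indQ * d" for d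
    by (simp add: op_QE_def op_Delta_def algebra_simps)
  show ?thesis unfolding 1 2 using indQ_nonzero by (simp add: field_simps)
qed

abbreviation all_Dv :: "nat \<Rightarrow> (int list \<Rightarrow> ratPQ) \<Rightarrow> int list \<Rightarrow> ratPQ" where
  "all_Dv n \<equiv> foldr Dv [0..<n]"

lemma all_Dv_var_ops: "all_Dv n \<in> var_ops {..<n}"
  by (intro op_algebra_foldr op_algebra.gen) auto

lemma all_Dv_snoc:
  assumes "length ls = n"
  shows "all_Dv (Suc n) C (ls @ [l]) = all_Dv n (\<lambda>ls. op_Delta (\<lambda>x. C (ls @ [x])) l) ls"
proof -
  have "all_Dv (Suc n) C (ls @ [l]) = all_Dv n (\<lambda>ls. Dv n C (ls @ [l])) ls"
    using var_ops_append[OF all_Dv_var_ops assms] by simp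
  also have "\<dots> = all_Dv n (\<lambda>ls. op_Delta (\<lambda>x. C (ls @ [x])) l) ls"
    by (rule var_ops_cong[OF all_Dv_var_ops _ assms]) (simp add: on_var_append)
  finally show ?thesis .
qed

text \<open>The sum over the last variable telescopes to \<open>op_QE h\<close> at the last entry
  minus \<open>op_Qid h\<close> at the one before. The former, together with the part of the latter
  that has \<open>op_Qid\<close> in every variable, is the new boundary sum; the rest is cancelled
  by the second summand of the recursion.\<close>

lemma summation_all_Dv:
  assumes "admissible S f N (n - 1) C"
  shows "summation S f n (all_Dv (n - 1) C) ks = boundary_sum n C ks"
  using assms
proof (induction n arbitrary: C rule: induct_nat_012)
  case 1
  then show ?case using linear_op_zero[OF linear_delta_ops[OF op_QE_delta]] by simp
next
  case (ge2 n)
  define A where "A = all_Dv (Suc n) C"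
  define h where "h = (\<lambda>x. boundary_sum (Suc n) (\<lambda>ls. C (ls @ [x])) ks)"
  define k where "k = ks ! n"
  have adm: "admissible S f N (Suc n) C" using ge2.prems by simp
  have D: "op_Delta \<in> delta_ops" by (auto intro: op_algebra.gen)
  \<comment> \<open>With the last argument frozen at \<open>l\<close>, the summand is again a full
    difference in the remaining variables; linearity of \<open>boundary_sum\<close> then brings the
    difference in the last variable outside.\<close>
  have 1: "summation S f (Suc n) (\<lambda>ls. A (ls @ [l])) ks = op_Delta h l" for l
  proof -
    have "summation S f (Suc n) (\<lambda>ls. A (ls @ [l])) ks
        = summation S f (Suc n) (all_Dv n (\<lambda>ls. op_Delta (\<lambda>x. C (ls @ [x])) l)) ks"
      by (rule summation_cong) (simp add: A_def all_Dv_snoc del: upt_Suc)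
    also have "\<dots> = boundary_sum (Suc n) (\<lambda>ls. op_Delta (\<lambda>x. C (ls @ [x])) l) ks"
      using ge2.IH(2)[of "\<lambda>ls. op_Delta (\<lambda>x. C (ls @ [x])) l"]
        admissible_delta[OF D, of S f N n "\<lambda>x ls. C (ls @ [x])" l] admissible_snoc[OF adm] by simp
    also have "\<dots> = op_Delta h l" unfolding h_def delta_ops_exchange[OF D linear_boundary_sum] ..
    finally show ?thesis .
  qed
  have 2: "op_Qid h k = op_Qid (\<lambda>y. op_QE (\<lambda>x. boundary_sum n (\<lambda>ls. C (ls @ [x, y])) ks) k) k
      + (- 1) ^ n * Qid_all (Suc n) C ks"
    unfolding h_def boundary_sum.simps k_def
    by (simp add: linear_op_add[OF linear_delta_ops[OF op_Qid_delta]]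
        linear_op_scale[OF linear_delta_ops[OF op_Qid_delta]])
  \<comment> \<open>This is the cancellation: the right-hand side is the unwanted part of
    \<open>op_Qid h k\<close>, with both of the last two variables evaluated at
    \<open>k\<close>.\<close>
  have 3: "summation S f n (\<lambda>ls. \<Sum>(i, j)\<in>S. const (f (i, j)) *
            op_E_pow i (\<lambda>x. op_E_pow j (\<lambda>y. A (ls @ [x, y])) k) k) ks
      = op_Qid (\<lambda>y. op_QE (\<lambda>x. boundary_sum n (\<lambda>ls. C (ls @ [x, y])) ks) k) k" (is "?L = ?R")
  proof (cases n)
    case 0
    \<comment> \<open>\<open>summation\<close> and \<open>boundary_sum\<close> are both zero at
      \<open>0\<close>, so nothing is left to cancel.\<close>
    then show ?thesis
      by (simp add: linear_op_zero[OF linear_delta_ops[OF op_QE_delta]]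
          linear_op_zero[OF linear_delta_ops[OF op_Qid_delta]])
  next
    case (Suc m)
    \<comment> \<open>\<open>M\<close> carries the differences in the last two variables, and
      \<open>C'\<close> adds the shift powers and the weights \<open>f\<close>. Differencing
      \<open>C'\<close> in the other \<open>m\<close> variables gives back the summand.\<close>
    define M where "M = (\<lambda>x y ls. op_Delta (\<lambda>x. op_Delta (\<lambda>y. C (ls @ [x, y])) y) x)"
    define C' where "C' = (\<lambda>ls. \<Sum>(i, j)\<in>S. const (f (i, j)) *
        trunc_E_pow N i (\<lambda>x. trunc_E_pow N j (\<lambda>y. M x y ls) k) k)"
    have admM: "admissible S f N m (M x y)" for x y
    proof -
      have 1: "admissible S f N m (\<lambda>ls. C (ls @ [x, y]))" for x y
        using admissible_snoc[OF admissible_snoc, of S f N m C x y] adm Suc by simp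
      have "admissible S f N m (\<lambda>ls. op_Delta (\<lambda>y. C (ls @ [x, y])) y)" for x
        using admissible_delta[OF D, of S f N m "\<lambda>y ls. C (ls @ [x, y])"] 1 by blast
      then show ?thesis unfolding M_def
        using admissible_delta[OF D, of S f N m "\<lambda>x ls. op_Delta (\<lambda>y. C (ls @ [x, y])) y"] by blast
    qed
    have "admissible S f N m (\<lambda>ls. case p of (i, j) \<Rightarrow> const (f (i, j)) *
        trunc_E_pow N i (\<lambda>x. trunc_E_pow N j (\<lambda>y. M x y ls) k) k)" for p
    proof (cases p)
      case (Pair i j)
      have "admissible S f N m (\<lambda>ls. trunc_E_pow N j (\<lambda>y. M x y ls) k)" for x
        using admissible_delta[OF trunc_E_pow_delta, of S f N m "M x"] admM by blast
      then have "admissible S f N m (\<lambda>ls. trunc_E_pow N i (\<lambda>x. trunc_E_pow N j (\<lambda>y. M x y ls) k) k)"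
        using admissible_delta[OF trunc_E_pow_delta, of S f N m "\<lambda>x ls. trunc_E_pow N j (\<lambda>y. M x y ls) k"]
        by blast
      from admissible_scale[OF this] show ?thesis using Pair by simp
    qed
    then have admC': "admissible S f N m C'"
      unfolding C'_def by (intro admissible_sum)
    have A_M: "A (ls @ [x, y]) = all_Dv m (M x y) ls" if ls: "length ls = m" for ls x y
    proof -
      have "A (ls @ [x, y]) = all_Dv (Suc m) (\<lambda>ls. op_Delta (\<lambda>y. C (ls @ [y])) y) (ls @ [x])"
        using all_Dv_snoc[of "ls @ [x]" "Suc m" C y] ls Suc by (simp add: A_def del: upt_Suc)
      also have "\<dots> = all_Dv m (M x y) ls" unfolding M_def using all_Dv_snoc[OF ls] by simp
      finally show ?thesis .
    qed
    have nilA: "nilpotent_fun N (Suc (Suc m)) A"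
      unfolding A_def using adm Suc by (intro nilpotent_fun_var_ops[OF _ all_Dv_var_ops]) (simp add: admissible_def)
    have "?L = summation S f n (all_Dv m C') ks"
    proof (rule summation_cong)
      fix ls :: "int list" assume "Suc (length ls) = n"
      then have ls: "length ls = m" using Suc by simp
      note ex = delta_ops_exchange[OF trunc_E_pow_delta linear_var_ops[OF all_Dv_var_ops]]
      have "all_Dv m C' ls = (\<Sum>(i, j)\<in>S. const (f (i, j)) *
            trunc_E_pow N i (\<lambda>x. trunc_E_pow N j (\<lambda>y. all_Dv m (M x y) ls) k) k)"
        unfolding C'_def
        by (simp add: split_beta linear_op_sum[OF linear_var_ops[OF all_Dv_var_ops]]
            linear_op_scale[OF linear_var_ops[OF all_Dv_var_ops]] ex)
      also have "\<dots> = (\<Sum>(i, j)\<in>S. const (f (i, j)) *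
            trunc_E_pow N i (\<lambda>x. trunc_E_pow N j (\<lambda>y. A (ls @ [x, y])) k) k)"
        using A_M[OF ls] by simp
      finally show "(\<Sum>(i, j)\<in>S. const (f (i, j)) *
            op_E_pow i (\<lambda>x. op_E_pow j (\<lambda>y. A (ls @ [x, y])) k) k) = all_Dv m C' ls"
        using op_E_pow_pair_eq_trunc[OF nilA ls] by simp
    qed
    also have "\<dots> = boundary_sum n C' ks" using ge2.IH(1)[of C'] admC' Suc by simp
    also have "\<dots> = boundary_sum n (\<lambda>ls. op_Qid (\<lambda>y. op_QE (\<lambda>x. C (ls @ [x, y])) k) k) ks"
    proof (rule boundary_sum_cong)
      fix ls :: "int list" assume "Suc (length ls) = n"
      then have ls: "length ls = m" using Suc by simp
      \<comment> \<open>Admissibility where the last two entries agree. The larger index comes first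
        because the recursion applies the power \<open>i\<close> to \<open>x\<close>, the earlier
        position, and \<open>j\<close> to \<open>y\<close>.\<close>
      have "trunc_pair_op S f N (Suc m) m C (ls @ [k, k]) = 0"
        using adm ls Suc by (simp add: admissible_def nth_append)
      moreover have "on_var (Suc m) op_Qid (on_var m op_QE C) (ls @ [k, k])
          = op_Qid (\<lambda>y. op_QE (\<lambda>x. C (ls @ [x, y])) k) k"
        using on_var_append[of "ls @ [k]" "Suc m" op_Qid "on_var m op_QE C" k "[]"] ls
          on_var_append[OF ls, of op_QE C k "[y]" for y] by simp
      moreover have "on_var m (trunc_E_pow N i) (on_var (Suc m) (trunc_E_pow N j) (Dv m (Dv (Suc m) C))) (ls @ [k, k])
          = trunc_E_pow N i (\<lambda>x. trunc_E_pow N j (\<lambda>y. M x y ls) k) k" for i j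
        unfolding on_var_append2[OF ls] M_def ..
      ultimately show "C' ls = op_Qid (\<lambda>y. op_QE (\<lambda>x. C (ls @ [x, y])) k) k"
        unfolding trunc_pair_op_alt C'_def by simp
    qed
    also have "\<dots> = ?R"
      by (simp add: delta_ops_exchange[OF op_Qid_delta linear_boundary_sum] delta_ops_exchange[OF op_QE_delta linear_boundary_sum])
    finally show ?thesis .
  qed
  have "summation S f (Suc (Suc n)) A ks
     = (op_QE h (ks ! Suc n) - op_Qid h k) + op_Qid (\<lambda>y. op_QE (\<lambda>x. boundary_sum n (\<lambda>ls. C (ls @ [x, y])) ks) k) k"
    unfolding summation.simps 1 esum_Delta op_QE_Qid_diff k_def[symmetric] 3 ..
  also have "\<dots> = boundary_sum (Suc (Suc n)) C ks"
    unfolding 2 by (subst boundary_sum.simps(2)[of "Suc n"]) (simp only: h_def power_Suc, simp)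
  finally show ?case by (simp add: A_def)
qed simp


section \<open>Products of pair operators\<close>

lemma Qid_all_append: "length ks = n \<Longrightarrow> Qid_all n C (ks @ vs) = Qid_all n C ks"
proof (induction n arbitrary: C ks vs)
  case (Suc n)
  then obtain us z where ks: "ks = us @ [z]" "length us = n" by (cases ks rule: rev_cases) auto
  then show ?case using Suc.IH[of us _ "z # vs"] Suc.IH[of us _ "[z]"] by (simp add: nth_append)
qed simp

lemma boundary_sum_append: "length ks = n \<Longrightarrow> boundary_sum n C (ks @ vs) = boundary_sum n C ks"
proof (induction n arbitrary: C ks vs)
  case (Suc n)
  then obtain us z where ks: "ks = us @ [z]" "length us = n" by (cases ks rule: rev_cases) auto
  then show ?case using Suc.IH[of us _ "z # vs"] Suc.IH[of us _ "[z]"]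
      Qid_all_append[of us n _ "z # vs"] Qid_all_append[of us n _ "[z]"] by (simp add: nth_append)
qed simp

text \<open>Indices refer to the list after entry \<open>r\<close> has been dropped: positions from
  \<open>r\<close> on hold the variables that followed it.\<close>

definition mixed_op :: "nat \<Rightarrow> nat \<Rightarrow> (int list \<Rightarrow> ratPQ) \<Rightarrow> int list \<Rightarrow> ratPQ" where
  "mixed_op r n C = foldr (\<lambda>s. on_var s op_Qid) [0..<r] (foldr (\<lambda>s. on_var s op_QE) [r..<n] C)"

lemma mixed_op_var_ops:
  assumes "r \<le> n"
  shows "mixed_op r n \<in> var_ops {..<n}"
proof -
  have "foldr (\<lambda>s. on_var s op_Qid) [0..<r] \<in> var_ops {..<n}"
    by (rule op_algebra_foldr, rule on_var_var_ops[OF op_Qid_delta]) (use assms in auto)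
  moreover have "foldr (\<lambda>s. on_var s op_QE) [r..<n] \<in> var_ops {..<n}"
    by (rule op_algebra_foldr, rule on_var_var_ops[OF op_QE_delta]) auto
  ultimately show ?thesis unfolding mixed_op_def[abs_def] by (rule op_algebra.comp)
qed

lemma mixed_op_snoc: "r \<le> n \<Longrightarrow> mixed_op r (Suc n) C = mixed_op r n (on_var n op_QE C)"
  by (simp add: mixed_op_def)

lemma Qid_all_eq_mixed_op: "length ks = n \<Longrightarrow> Qid_all n C ks = mixed_op n n C ks"
proof (induction n arbitrary: C ks)
  case (Suc n)
  then obtain us z where ks: "ks = us @ [z]" "length us = n" by (cases ks rule: rev_cases) auto
  have "Qid_all (Suc n) C ks = op_Qid (\<lambda>y. mixed_op n n (\<lambda>ls. C (ls @ [y])) us) z"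
    using ks Suc.IH by (simp add: Qid_all_append nth_append)
  also have "\<dots> = op_Qid (\<lambda>y. mixed_op n n C (us @ [y])) z"
    using var_ops_append[OF mixed_op_var_ops ks(2), of n C] by simp
  also have "\<dots> = on_var n op_Qid (mixed_op n n C) ks"
    using on_var_append[OF ks(2), of op_Qid "mixed_op n n C" z "[]"] ks by simp
  also have "\<dots> = mixed_op n n (on_var n op_Qid C) ks"
    using var_ops_commute[OF on_var_var_ops[OF op_Qid_delta UNIV_I] mixed_op_var_ops[OF order_refl]] by simp
  finally show ?case by (simp add: mixed_op_def)
qed (simp add: mixed_op_def)

definition drop_nth :: "nat \<Rightarrow> 'a list \<Rightarrow> 'a list" where
  "drop_nth r ks = take r ks @ drop (Suc r) ks"

lemma length_drop_nth: "r < length ks \<Longrightarrow> length (drop_nth r ks) = length ks - 1"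
  by (simp add: drop_nth_def)

lemma nth_drop_nth: "r < length ks \<Longrightarrow> i < length ks - 1 \<Longrightarrow> drop_nth r ks ! i = (if i < r then ks ! i else ks ! Suc i)"
  by (auto simp: drop_nth_def nth_append)

lemma drop_nth_snoc: "r < length ks \<Longrightarrow> drop_nth r (ks @ [z]) = drop_nth r ks @ [z]"
  by (simp add: drop_nth_def)

text \<open>In the recursion, a term that omits an earlier entry acquires \<open>op_QE\<close> in
  the last variable, while the added term omits the last entry and has \<open>op_Qid\<close>
  everywhere.\<close>

lemma boundary_sum_eq_mixed_op:
  "length ks = n \<Longrightarrow> boundary_sum n C ks = (\<Sum>r<n. (- 1) ^ r * mixed_op r (n - 1) C (drop_nth r ks))"
proof (induction n arbitrary: C ks)
  case (Suc n)
  then obtain us z where ks: "ks = us @ [z]" "length us = n" by (cases ks rule: rev_cases) auto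
  note L = linear_delta_ops[OF op_QE_delta]
  have "op_QE (\<lambda>x. mixed_op r (n - 1) (\<lambda>ls. C (ls @ [x])) (drop_nth r us)) z = mixed_op r n C (drop_nth r us @ [z])"
    if "r < n" for r
  proof -
    have len: "length (drop_nth r us) = n - 1" using that ks by (simp add: length_drop_nth)
    have r: "r \<le> n - 1" using that by simp
    have "op_QE (\<lambda>x. mixed_op r (n - 1) (\<lambda>ls. C (ls @ [x])) (drop_nth r us)) z
        = op_QE (\<lambda>x. mixed_op r (n - 1) C (drop_nth r us @ [x])) z"
      using var_ops_append[OF mixed_op_var_ops[OF r] len, of C] by simp
    also have "\<dots> = on_var (n - 1) op_QE (mixed_op r (n - 1) C) (drop_nth r us @ [z])"
      using on_var_append[OF len, of op_QE "mixed_op r (n - 1) C" z "[]"] by simp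
    also have "\<dots> = mixed_op r (n - 1) (on_var (n - 1) op_QE C) (drop_nth r us @ [z])"
      using var_ops_commute[OF on_var_var_ops[OF op_QE_delta UNIV_I] mixed_op_var_ops[OF r]] by simp
    also have "\<dots> = mixed_op r n C (drop_nth r us @ [z])"
      using mixed_op_snoc[OF r, of C] that by simp
    finally show ?thesis .
  qed
  then have "(\<Sum>r<n. (- 1) ^ r * op_QE (\<lambda>x. mixed_op r (n - 1) (\<lambda>ls. C (ls @ [x])) (drop_nth r us)) z)
      = (\<Sum>r<n. (- 1) ^ r * mixed_op r n C (drop_nth r ks))"
    using ks by (simp add: drop_nth_snoc)
  moreover have "op_QE (\<lambda>x. boundary_sum n (\<lambda>ls. C (ls @ [x])) ks) (ks ! n)
      = (\<Sum>r<n. (- 1) ^ r * op_QE (\<lambda>x. mixed_op r (n - 1) (\<lambda>ls. C (ls @ [x])) (drop_nth r us)) z)"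
    using ks Suc.IH by (simp add: boundary_sum_append nth_append linear_op_sum[OF L] linear_op_scale[OF L])
  moreover have "Qid_all n C ks = mixed_op n n C (drop_nth n ks)"
    using ks by (simp add: Qid_all_append Qid_all_eq_mixed_op drop_nth_def)
  ultimately show ?case by simp
qed simp

section \<open>Transport of operators along reindexings\<close>

lemma on_var_cong:
  assumes "\<And>ls. length ls = n \<Longrightarrow> F ls = G ls" "length ls = n"
  shows "on_var s T F ls = on_var s T G ls"
  using assms by (simp add: on_var_def)

text \<open>\<open>g\<close> reindexes lists so that position \<open>s\<close> becomes position
  \<open>s'\<close>. This serves both for omitting an entry and for swapping two neighbours.\<close>

lemma on_var_transport:
  assumes "\<And>ls x. length ls = n \<Longrightarrow> g (ls[s := x]) = (g ls)[s' := x]"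
    and "\<And>ls. length ls = n \<Longrightarrow> g ls ! s' = ls ! s"
    and "\<And>ls. length ls = n \<Longrightarrow> H ls = K (g ls)" "length ls = n"
  shows "on_var s T H ls = on_var s' T K (g ls)"
  using assms by (simp add: on_var_def)

lemma trunc_pair_op_transport:
  assumes "\<And>ls x. length ls = n \<Longrightarrow> g (ls[s := x]) = (g ls)[s' := x]"
    and "\<And>ls. length ls = n \<Longrightarrow> g ls ! s' = ls ! s"
    and "\<And>ls x. length ls = n \<Longrightarrow> g (ls[t := x]) = (g ls)[t' := x]"
    and "\<And>ls. length ls = n \<Longrightarrow> g ls ! t' = ls ! t"
    and "\<And>ls. length ls = n \<Longrightarrow> H ls = K (g ls)" "length ls = n"
  shows "trunc_pair_op S f N s t H ls = trunc_pair_op S f N s' t' K (g ls)"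
proof -
  have s: "on_var s T F ls = on_var s' T G (g ls)"
    if "length ls = n" "\<And>ls. length ls = n \<Longrightarrow> F ls = G (g ls)" for T F G ls
    using on_var_transport[of n g s s' F G ls T] assms(1,2) that by blast
  have t: "on_var t T F ls = on_var t' T G (g ls)"
    if "length ls = n" "\<And>ls. length ls = n \<Longrightarrow> F ls = G (g ls)" for T F G ls
    using on_var_transport[of n g t t' F G ls T] assms(3,4) that by blast
  have 1: "on_var s op_Qid (on_var t op_QE H) ls = on_var s' op_Qid (on_var t' op_QE K) (g ls)"
    by (rule s[OF assms(6)], rule t, assumption, rule assms(5))
  have "on_var t T (on_var s U (Dv t (Dv s H))) ls = on_var t' T (on_var s' U (Dv t' (Dv s' K))) (g ls)"
    for T U
    by (rule t[OF assms(6)], rule s, assumption, rule t, assumption, rule s, assumption, rule assms(5))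
  then show ?thesis unfolding trunc_pair_op_alt 1 by simp
qed

text \<open>Constancy in one of the two variables kills the double difference and reduces the
  remaining operator in that variable to multiplication by \<open>indQ\<close>.\<close>

lemma trunc_pair_op_const:
  assumes "length ls = n"
  shows "(\<And>ls. length ls = n \<Longrightarrow> Dv s H ls = 0) \<Longrightarrow> trunc_pair_op S f N s t H ls = indQ * on_var t op_QE H ls"
    and "(\<And>ls. length ls = n \<Longrightarrow> Dv t H ls = 0) \<Longrightarrow> trunc_pair_op S f N s t H ls = indQ * on_var s op_Qid H ls"
proof -
  note v = on_var_var_ops[OF _ UNIV_I]
  have 0: "on_var t U (on_var s V (\<lambda>_. 0)) ls = 0" if "U \<in> delta_ops" "V \<in> delta_ops" for U V s t
    using that by (simp add: linear_op_zero[OF linear_var_ops[OF v]])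
  have 1: "on_var t (trunc_E_pow N i) (on_var s (trunc_E_pow N j) (Dv t (Dv s H))) ls = 0"
    if const: "(\<forall>ls. length ls = n \<longrightarrow> Dv s H ls = 0) \<or> (\<forall>ls. length ls = n \<longrightarrow> Dv t H ls = 0)"
    for i j
  proof -
    have Dv0: "Dv u (Dv v H) ls = 0"
      if "\<forall>ls. length ls = n \<longrightarrow> Dv v H ls = 0" "length ls = n" for u v ls
      using on_var_cong[of n "Dv v H" "\<lambda>_. 0" ls u op_Delta] that by (simp add: Dv_eq)
    have "Dv t (Dv s H) ls = 0" if "length ls = n" for ls
      using const Dv0[OF _ that] Dv_commute[of s t H] by metis
    then have "on_var t (trunc_E_pow N i) (on_var s (trunc_E_pow N j) (Dv t (Dv s H))) ls
        = on_var t (trunc_E_pow N i) (on_var s (trunc_E_pow N j) (\<lambda>_. 0)) ls"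
      by (intro on_var_cong[of n] assms) auto
    then show ?thesis using 0[OF trunc_E_pow_delta trunc_E_pow_delta] by simp
  qed
  have Qid: "on_var s op_Qid G ls = indQ * (Dv s G ls + G ls) - Dv s G ls" for G s ls
    by (simp add: on_var_def op_Qid_def op_E_def)
  have QE: "on_var s op_QE G ls = indQ * G ls + Dv s G ls" for G s ls
    by (simp add: on_var_def op_QE_def)
  note sc = linear_op_scale[OF linear_var_ops[OF v]]
  show "trunc_pair_op S f N s t H ls = indQ * on_var t op_QE H ls"
    if H: "\<And>ls. length ls = n \<Longrightarrow> Dv s H ls = 0"
  proof -
    have "on_var t op_QE (on_var s op_Qid H) ls = on_var t op_QE (\<lambda>ls. indQ * H ls) ls"
      by (rule on_var_cong[OF _ assms]) (simp add: Qid H)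
    moreover have "on_var t op_QE (on_var s op_Qid H) ls = on_var s op_Qid (on_var t op_QE H) ls"
      using var_ops_commute[OF v[OF op_QE_delta] v[OF op_Qid_delta]] by simp
    ultimately show ?thesis unfolding trunc_pair_op_alt
      using 1 H by (simp add: sc[OF op_QE_delta] split_beta)
  qed
  show "trunc_pair_op S f N s t H ls = indQ * on_var s op_Qid H ls"
    if H: "\<And>ls. length ls = n \<Longrightarrow> Dv t H ls = 0"
  proof -
    have "on_var s op_Qid (on_var t op_QE H) ls = on_var s op_Qid (\<lambda>ls. indQ * H ls) ls"
      by (rule on_var_cong[OF _ assms]) (simp add: QE H)
    then show ?thesis unfolding trunc_pair_op_alt
      using 1 H by (simp add: sc[OF op_Qid_delta] split_beta)
  qed
qed

section \<open>Products of pair operators on functions that omit a variable\<close>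

definition pairs :: "nat \<Rightarrow> (nat \<times> nat) list" where
  "pairs n = [(s, t). t \<leftarrow> [0..<n], s \<leftarrow> [0..<t]]"

lemma pairs_Suc: "pairs (Suc n) = pairs n @ map (\<lambda>s. (s, n)) [0..<n]"
  by (simp add: pairs_def)

lemma set_pairs: "set (pairs n) = {(s, t). s < t \<and> t < n}"
  by (auto simp: pairs_def)

lemma distinct_pairs: "distinct (pairs n)"
proof (induction n)
  case (Suc n)
  then show ?case by (auto simp: pairs_Suc set_pairs distinct_map inj_on_def)
qed (simp add: pairs_def)

definition trunc_prod ::
  "(int \<times> int) set \<Rightarrow> (int \<times> int \<Rightarrow> complex) \<Rightarrow> nat \<Rightarrow> nat \<Rightarrow> (int list \<Rightarrow> ratPQ) \<Rightarrow> int list \<Rightarrow> ratPQ"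
where
  "trunc_prod S f N n = foldr (\<lambda>(s, t). trunc_pair_op S f N s t) (pairs n)"

text \<open>These are the factors by which the product grows when variable \<open>t\<close> is
  added, so that an omission can be followed one row at a time.\<close>

definition trunc_row ::
  "(int \<times> int) set \<Rightarrow> (int \<times> int \<Rightarrow> complex) \<Rightarrow> nat \<Rightarrow> nat \<Rightarrow> (int list \<Rightarrow> ratPQ) \<Rightarrow> int list \<Rightarrow> ratPQ"
where
  "trunc_row S f N t = foldr (\<lambda>s. trunc_pair_op S f N s t) [0..<t]"

lemma trunc_prod_Suc: "trunc_prod S f N (Suc n) F = trunc_prod S f N n (trunc_row S f N n F)"
  by (simp add: trunc_prod_def trunc_row_def pairs_Suc foldr_map comp_def)

lemma foldr_pair_var_ops:
  "set ps \<subseteq> A \<times> A \<Longrightarrow> foldr (\<lambda>(s, t). trunc_pair_op S f N s t) ps \<in> var_ops A"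
  by (rule op_algebra_foldr) (auto intro: trunc_pair_op_var_ops)

lemma trunc_prod_var_ops: "trunc_prod S f N n \<in> var_ops {..<n}"
  unfolding trunc_prod_def by (rule foldr_pair_var_ops) (auto simp: set_pairs)

lemma trunc_row_var_ops: "trunc_row S f N t \<in> var_ops UNIV"
  unfolding trunc_row_def by (rule op_algebra_foldr) (auto intro: trunc_pair_op_var_ops)

lemma foldr_transport:
  assumes "\<And>ls. length ls = n \<Longrightarrow> H ls = K (g ls)" "length ls = n"
    and "\<And>x H K ls. x \<in> set xs \<Longrightarrow> length ls = n \<Longrightarrow> (\<And>ls. length ls = n \<Longrightarrow> H ls = K (g ls))
           \<Longrightarrow> T x H ls = U x K (g ls)"
  shows "foldr T xs H ls = foldr U xs K (g ls)"
  using assms(2,3)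
proof (induction xs arbitrary: ls)
  case Nil
  then show ?case using assms(1) by simp
next
  case (Cons x xs)
  have "foldr T xs H ls = foldr U xs K (g ls)" if "length ls = n" for ls
    using Cons.IH[OF that] Cons.prems(2) by simp
  then show ?case using Cons.prems by simp
qed

lemma drop_nth_update_before: "s < r \<Longrightarrow> drop_nth r (ls[s := x]) = (drop_nth r ls)[s := x]"
  by (cases "s < length ls") (auto simp: drop_nth_def take_update_swap list_update_append list_update_beyond)

lemma drop_nth_update_after:
  assumes "r < s" "r < length ls"
  shows "drop_nth r (ls[s := x]) = (drop_nth r ls)[s - 1 := x]"
proof -
  have "drop (Suc r) (ls[s := x]) = (drop (Suc r) ls)[s - Suc r := x]"
    using assms by (simp add: drop_update_swap)
  moreover have "\<not> s - Suc 0 < r" using assms(1) by simp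
  ultimately show ?thesis using assms by (simp add: drop_nth_def list_update_append)
qed

lemma drop_nth_update_same: "drop_nth r (ls[r := x]) = drop_nth r ls"
  by (simp add: drop_nth_def)

text \<open>\<open>H\<close> is constant in variable \<open>r\<close>. Factors avoiding
  \<open>r\<close> keep their form, with indices beyond \<open>r\<close> lowered by one; factors
  involving \<open>r\<close> degenerate by \<open>trunc_pair_op_const\<close>.\<close>

lemma trunc_pair_op_del:
  assumes "r \<le> n" "length ls = Suc n" "\<And>ls. length ls = Suc n \<Longrightarrow> H ls = K (drop_nth r ls)"
  shows "s < t \<Longrightarrow> t < r \<Longrightarrow> trunc_pair_op S f N s t H ls = trunc_pair_op S f N s t K (drop_nth r ls)"
    and "s < r \<Longrightarrow> trunc_pair_op S f N s r H ls = indQ * on_var s op_Qid K (drop_nth r ls)"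
    and "s < r \<Longrightarrow> r < t \<Longrightarrow> t \<le> n \<Longrightarrow> trunc_pair_op S f N s t H ls = trunc_pair_op S f N s (t - 1) K (drop_nth r ls)"
    and "r < t \<Longrightarrow> t \<le> n \<Longrightarrow> trunc_pair_op S f N r t H ls = indQ * on_var (t - 1) op_QE K (drop_nth r ls)"
    and "r < s \<Longrightarrow> s < t \<Longrightarrow> t \<le> n \<Longrightarrow>
           trunc_pair_op S f N s t H ls = trunc_pair_op S f N (s - 1) (t - 1) K (drop_nth r ls)"
proof -
  have before: "drop_nth r (ls[s := x]) = (drop_nth r ls)[s := x]" "drop_nth r ls ! s = ls ! s"
    if "s < r" "length ls = Suc n" for s x and ls :: "int list"
    using that assms(1) by (auto simp: drop_nth_update_before nth_drop_nth)
  have after: "drop_nth r (ls[s := x]) = (drop_nth r ls)[s - 1 := x]" "drop_nth r ls ! (s - 1) = ls ! s"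
    if "r < s" "s \<le> n" "length ls = Suc n" for s x and ls :: "int list"
    using that assms(1) by (auto simp: drop_nth_update_after nth_drop_nth)
  have const: "Dv r H ls = 0" if "length ls = Suc n" for ls
    using that assms(3) by (simp add: Dv_eq drop_nth_update_same)
  show "trunc_pair_op S f N s t H ls = trunc_pair_op S f N s t K (drop_nth r ls)" if "s < t" "t < r"
    by (rule trunc_pair_op_transport[of "Suc n"]) (use before that assms in auto)
  show "trunc_pair_op S f N s t H ls = trunc_pair_op S f N s (t - 1) K (drop_nth r ls)"
    if "s < r" "r < t" "t \<le> n"
    by (rule trunc_pair_op_transport[of "Suc n"]) (use before after that assms in auto)
  show "trunc_pair_op S f N s t H ls = trunc_pair_op S f N (s - 1) (t - 1) K (drop_nth r ls)"
    if "r < s" "s < t" "t \<le> n"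
    by (rule trunc_pair_op_transport[of "Suc n"]) (use after that assms in auto)
  show "trunc_pair_op S f N s r H ls = indQ * on_var s op_Qid K (drop_nth r ls)" if "s < r"
  proof -
    have "on_var s op_Qid H ls = on_var s op_Qid K (drop_nth r ls)"
      by (rule on_var_transport[of "Suc n"]) (use before that assms in auto)
    then show ?thesis using trunc_pair_op_const(2)[OF assms(2) const] by simp
  qed
  show "trunc_pair_op S f N r t H ls = indQ * on_var (t - 1) op_QE K (drop_nth r ls)" if "r < t" "t \<le> n"
  proof -
    have "on_var t op_QE H ls = on_var (t - 1) op_QE K (drop_nth r ls)"
      by (rule on_var_transport[of "Suc n"]) (use after that assms in auto)
    then show ?thesis using trunc_pair_op_const(1)[OF assms(2) const] by simp
  qed
qed

lemma upt_split: "i \<le> j \<Longrightarrow> j \<le> k \<Longrightarrow> [i..<j] @ [j..<k] = [i..<k]"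
  by (metis le_add_diff_inverse upt_add_eq_append)

lemma trunc_row_del_same:
  assumes "r \<le> n" "length ls = Suc n" "\<And>ls. length ls = Suc n \<Longrightarrow> H ls = K (drop_nth r ls)"
  shows "trunc_row S f N r H ls = indQ ^ r * mixed_op r r K (drop_nth r ls)"
proof -
  have "trunc_row S f N r H ls = foldr (\<lambda>s K ls. indQ * on_var s op_Qid K ls) [0..<r] K (drop_nth r ls)"
    unfolding trunc_row_def
    by (rule foldr_transport[where g = "drop_nth r" and n = "Suc n" and H = H and K = K, OF assms(3) assms(2)]) (use trunc_pair_op_del(2)[OF assms(1)] in auto)
  moreover have "foldr (\<lambda>s K ls. indQ * on_var s op_Qid K ls) xs K
      = (\<lambda>ls. indQ ^ length xs * foldr (\<lambda>s. on_var s op_Qid) xs K ls)" for xs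
  proof (induction xs)
    case (Cons s xs)
    then show ?case
      using linear_op_scale[OF linear_var_ops[OF on_var_var_ops[OF op_Qid_delta UNIV_I]], of s]
      by (simp add: mult_ac)
  qed simp
  ultimately show ?thesis by (simp add: mixed_op_def)
qed

lemma trunc_row_del_after:
  assumes "r \<le> n" "length ls = Suc n" "\<And>ls. length ls = Suc n \<Longrightarrow> H ls = K (drop_nth r ls)"
    and "r \<le> t" "Suc t \<le> n"
  shows "trunc_row S f N (Suc t) H ls = indQ * on_var t op_QE (trunc_row S f N t K) (drop_nth r ls)"
proof -
  let ?W = "\<lambda>s. trunc_pair_op S f N s t"
  let ?T = "\<lambda>s. trunc_pair_op S f N s (Suc t)"
  \<comment> \<open>The row is cut at \<open>r\<close>: smaller indices stay, \<open>r\<close>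
    itself yields \<open>op_QE\<close>, and larger ones are written as successors because they drop
    by one.\<close>
  have split: "[0..<Suc t] = [0..<r] @ r # map Suc [r..<t]"
    using upt_split[of 0 r "Suc t"] assms(4) by (simp add: upt_conv_Cons map_Suc_upt del: upt_Suc)
  have 1: "foldr ?T (map Suc [r..<t]) H ls = foldr ?W [r..<t] K (drop_nth r ls)" if "length ls = Suc n" for ls
    unfolding foldr_map comp_def
    by (rule foldr_transport[where g = "drop_nth r" and n = "Suc n" and H = H and K = K, OF assms(3) that]) (use trunc_pair_op_del(5)[OF assms(1)] assms(5) in auto)
  have 2: "?T r (foldr ?T (map Suc [r..<t]) H) ls
      = indQ * on_var t op_QE (foldr ?W [r..<t] K) (drop_nth r ls)" if "length ls = Suc n" for ls
    using trunc_pair_op_del(4)[OF assms(1) that, of "foldr ?T (map Suc [r..<t]) H" "foldr ?W [r..<t] K" "Suc t"] 1 assms(4,5) by simp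
  have W: "foldr ?W xs \<in> var_ops UNIV" for xs
    by (rule op_algebra_foldr) (auto intro: trunc_pair_op_var_ops)
  have "trunc_row S f N (Suc t) H ls
      = foldr ?T [0..<r] (?T r (foldr ?T (map Suc [r..<t]) H)) ls"
    unfolding trunc_row_def split by simp
  also have "\<dots> = foldr ?W [0..<r] (\<lambda>ls. indQ * on_var t op_QE (foldr ?W [r..<t] K) ls) (drop_nth r ls)"
    by (rule foldr_transport[where g = "drop_nth r" and n = "Suc n" and H = "?T r (foldr ?T (map Suc [r..<t]) H)"
          and K = "\<lambda>ls. indQ * on_var t op_QE (foldr ?W [r..<t] K) ls", OF 2 assms(2)]) (use trunc_pair_op_del(3)[OF assms(1)] assms(4,5) in auto)
  also have "\<dots> = indQ * on_var t op_QE (foldr ?W [0..<r] (foldr ?W [r..<t] K)) (drop_nth r ls)"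
    using linear_op_scale[OF linear_var_ops[OF W]]
      var_ops_commute[OF W on_var_var_ops[OF op_QE_delta UNIV_I]] by simp
  also have "foldr ?W [0..<r] (foldr ?W [r..<t] K) = trunc_row S f N t K"
    unfolding trunc_row_def using upt_split[of 0 r t] assms(4) by (metis comp_apply foldr_append le0)
  finally show ?thesis .
qed

lemma trunc_prod_del_before:
  assumes "r \<le> n" "length ls = Suc n" "\<And>ls. length ls = Suc n \<Longrightarrow> H ls = K (drop_nth r ls)" "t \<le> r"
  shows "trunc_prod S f N t H ls = trunc_prod S f N t K (drop_nth r ls)"
  unfolding trunc_prod_def
  by (rule foldr_transport[where g = "drop_nth r" and n = "Suc n" and H = H and K = K, OF assms(3) assms(2)])
     (use trunc_pair_op_del(1)[OF assms(1)] assms(4) in \<open>auto simp: set_pairs\<close>)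

text \<open>Rows below \<open>r\<close> are unchanged, row \<open>r\<close> supplies all the
  \<open>op_Qid\<close> and \<open>indQ ^ r\<close>, and every later row turns into its predecessor
  together with one \<open>op_QE\<close> and one factor \<open>indQ\<close>.\<close>

lemma trunc_prod_del:
  assumes "r \<le> n" "length ls = Suc n" "\<And>ls. length ls = Suc n \<Longrightarrow> H ls = K (drop_nth r ls)"
    and "r \<le> k" "k \<le> n"
  shows "trunc_prod S f N (Suc k) H ls = indQ ^ k * trunc_prod S f N k (mixed_op r k K) (drop_nth r ls)"
  using assms(4,5,3)
proof (induction k arbitrary: H K rule: dec_induct)
  case base
  have "trunc_prod S f N (Suc r) H ls
      = trunc_prod S f N r (\<lambda>ls. indQ ^ r * mixed_op r r K ls) (drop_nth r ls)"
    unfolding trunc_prod_Suc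
    by (rule trunc_prod_del_before[OF assms(1,2) _ order_refl])
       (rule trunc_row_del_same[OF assms(1), of _ H K], assumption, rule base(2))
  then show ?case by (simp add: linear_op_scale[OF linear_var_ops[OF trunc_prod_var_ops]])
next
  case (step k)
  let ?K = "\<lambda>ls. indQ * on_var k op_QE (trunc_row S f N k K) ls"
  have "trunc_row S f N (Suc k) H ls = ?K (drop_nth r ls)" if "length ls = Suc n" for ls
    by (rule trunc_row_del_after[OF assms(1) that, of H K, OF step.prems(2)]) (use step in auto)
  then have "trunc_prod S f N (Suc (Suc k)) H ls
      = indQ ^ k * trunc_prod S f N k (mixed_op r k ?K) (drop_nth r ls)"
    unfolding trunc_prod_Suc[of S f N "Suc k"] using step.prems(1) by (intro step.IH) auto
  moreover have "mixed_op r k ?K = (\<lambda>ls. indQ * mixed_op r (Suc k) (trunc_row S f N k K) ls)"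
    using step.hyps by (simp add: linear_op_scale[OF linear_var_ops[OF mixed_op_var_ops]] mixed_op_snoc)
  moreover have "mixed_op r (Suc k) (trunc_row S f N k K) = trunc_row S f N k (mixed_op r (Suc k) K)"
    using step.hyps var_ops_commute[OF mixed_op_var_ops trunc_row_var_ops] by simp
  ultimately show ?case
    by (simp add: linear_op_scale[OF linear_var_ops[OF trunc_prod_var_ops]] trunc_prod_Suc)
qed

section \<open>Symmetry under swaps of neighbouring variables\<close>

definition adj_swap :: "nat \<Rightarrow> 'a list \<Rightarrow> 'a list" where
  "adj_swap i ls = ls[i := ls ! Suc i, Suc i := ls ! i]"

lemma adj_swap_update:
  assumes "Suc i < length ls"
  shows "adj_swap i (ls[s := x]) = (adj_swap i ls)[transpose i (Suc i) s := x]"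
  using assms by (intro nth_equalityI) (auto simp: adj_swap_def transpose_def nth_list_update)

lemma adj_swap_nth:
  assumes "Suc i < length ls"
  shows "adj_swap i ls ! transpose i (Suc i) s = ls ! s"
  using assms by (auto simp: adj_swap_def transpose_def nth_list_update)

text \<open>Swapping the labels \<open>i\<close> and \<open>Suc i\<close> preserves the order within
  every pair except \<open>(i, Suc i)\<close>, because no index lies between them. The added
  reversed pair makes the collection invariant.\<close>

lemma adj_swap_pairs:
  assumes "Suc i < n"
  shows "mset (map (map_prod (transpose i (Suc i)) (transpose i (Suc i))) ((Suc i, i) # pairs n))
       = mset ((Suc i, i) # pairs n)" (is "mset (map ?g ?xs) = _")
proof -
  have inv: "?g (?g p) = p" for p by (cases p) simp
  have sub: "?g p \<in> set ?xs" if "p \<in> set ?xs" for p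
    using that assms by (auto simp: set_pairs transpose_def split: if_splits)
  have d: "distinct ?xs" by (auto simp: distinct_pairs set_pairs)
  have "?g ` set ?xs = set ?xs"
  proof (intro equalityI subsetI)
    fix p assume "p \<in> set ?xs"
    then have "?g p \<in> set ?xs" by (rule sub)
    then show "p \<in> ?g ` set ?xs" using inv[of p] by (intro image_eqI[of p ?g "?g p"]) (simp del: map_prod_simp)+
  next
    fix p assume "p \<in> ?g ` set ?xs"
    then obtain q where "q \<in> set ?xs" "p = ?g q" by (rule imageE)
    then show "p \<in> set ?xs" using sub by simp
  qed
  then have "set (map ?g ?xs) = set ?xs" by (simp only: set_map)
  moreover have "inj ?g" using inv by (metis injI)
  then have "distinct (map ?g ?xs)"
    unfolding distinct_map using d inj_on_subset[OF _ subset_UNIV] by blast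
  ultimately show ?thesis using d set_eq_iff_mset_eq_distinct by blast
qed

lemma foldr_pair_perm:
  assumes "mset ps = mset qs"
  shows "foldr (\<lambda>(s, t). trunc_pair_op S f N s t) ps = foldr (\<lambda>(s, t). trunc_pair_op S f N s t) qs"
proof -
  have "trunc_pair_op S f N s t (trunc_pair_op S f N s' t' F)
      = trunc_pair_op S f N s' t' (trunc_pair_op S f N s t F)" for s t s' t' F
    using var_ops_commute[OF trunc_pair_op_var_ops trunc_pair_op_var_ops] UNIV_I by metis
  then show ?thesis unfolding foldr_conv_fold
    by (intro fold_multiset_equiv) (use assms in \<open>auto simp: fun_eq_iff\<close>)
qed

lemma two_nonzero: "(2 :: ratPQ) \<noteq> 0"
proof -
  have "(2 :: ratPQ) = to_fract 2" by (metis one_add_one to_fract_1 to_fract_add)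
  moreover have "(2 :: complex poly poly) \<noteq> 0" by simp
  ultimately show ?thesis by (metis to_fract_eq_0_iff)
qed

lemma admissible_trunc_prod:
  assumes "nilpotent_fun N n B"
    and "\<And>ls i. length ls = n \<Longrightarrow> Suc i < n \<Longrightarrow> B ls = - B (adj_swap i ls)"
  shows "admissible S f N n (trunc_prod S f N n B)"
proof -
  have "trunc_pair_op S f N (Suc i) i (trunc_prod S f N n B) ls = 0"
    if ls: "length ls = n" and i: "Suc i < n" and eq: "ls ! i = ls ! Suc i" for ls i
  proof -
    let ?W = "\<lambda>(s, t). trunc_pair_op S f N s t"
    let ?xs = "(Suc i, i) # pairs n"
    let ?tr = "transpose i (Suc i)"
    \<comment> \<open>Relabelling permutes the factors and turns \<open>B\<close> into its negative.
      As the swap fixes \<open>ls\<close>, the value equals its own negative.\<close>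
    have "foldr ?W ?xs B ls = foldr (?W \<circ> map_prod ?tr ?tr) ?xs (\<lambda>ls. - B ls) (adj_swap i ls)"
    proof (rule foldr_transport[where g = "adj_swap i" and H = B and K = "\<lambda>ls. - B ls", OF _ ls])
      show "B ls = - B (adj_swap i ls)" if "length ls = n" for ls using assms(2) that i by blast
      show "?W p H ls = (?W \<circ> map_prod ?tr ?tr) p K (adj_swap i ls)"
        if "length ls = n" "\<And>ls. length ls = n \<Longrightarrow> H ls = K (adj_swap i ls)" for p H K ls
      proof (cases p)
        case (Pair s t)
        show ?thesis unfolding Pair using i that
          by (simp add: trunc_pair_op_transport[of n "adj_swap i" s "?tr s" t "?tr t" H K]
              adj_swap_update adj_swap_nth)
      qed
    qed
    also have "adj_swap i ls = ls"
      using eq by (simp add: adj_swap_def) (metis eq list_update_id)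
    also have "foldr (?W \<circ> map_prod ?tr ?tr) ?xs = foldr ?W (map (map_prod ?tr ?tr) ?xs)"
      by (rule ext, rule ext) (simp only: foldr_map)
    also have "\<dots> = foldr ?W ?xs" by (rule foldr_pair_perm[OF adj_swap_pairs[OF i]])
    also have "foldr ?W ?xs (\<lambda>ls. - B ls) ls = - foldr ?W ?xs B ls"
      using linear_op_scale[OF linear_var_ops[OF foldr_pair_var_ops[of ?xs UNIV]], of S f N "-1" B]
      by simp
    finally have "2 * foldr ?W ?xs B ls = 0" by (simp add: eq_neg_iff_add_eq_0 flip: mult_2)
    then show ?thesis using two_nonzero by (simp add: trunc_prod_def)
  qed
  then show ?thesis
    using nilpotent_fun_var_ops[OF assms(1) trunc_prod_var_ops] by (simp add: admissible_def)
qed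

section \<open>Return to the operators without truncation\<close>

lemma nilpotent_fun_update:
  assumes "nilpotent_fun N n F" "length ls = n" "s < n"
  shows "(op_Delta ^^ N) (\<lambda>x. F (ls[s := x])) = (\<lambda>_. 0)"
proof
  fix x
  have "(op_Delta ^^ N) (\<lambda>x. F (ls[s := x])) x = on_var s (op_Delta ^^ N) F (ls[s := x])"
    using assms by (simp add: on_var_def)
  also have "\<dots> = (Dv s ^^ N) F (ls[s := x])"
    using on_var_funpow[of op_Delta s N] by (simp add: op_algebra.gen)
  finally show "(op_Delta ^^ N) (\<lambda>x. F (ls[s := x])) x = 0"
    using assms by (simp add: nilpotent_fun_def)
qed

lemma on_var_op_E_pow:
  assumes "nilpotent_fun N n F" "length ls = n" "s < n"
  shows "on_var s (op_E_pow i) F ls = on_var s (trunc_E_pow N i) F ls"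
  using op_E_pow_eq_trunc[OF nilpotent_fun_update[OF assms]] by (simp add: on_var_def)

lemma pair_op_eq_trunc:
  assumes "nilpotent_fun N n F" "length ls = n" "s < n" "t < n"
  shows "pair_op S f s t F ls = trunc_pair_op S f N s t F ls"
proof -
  have "on_var t (op_E_pow i) (on_var s (op_E_pow j) F) ls
      = on_var t (trunc_E_pow N i) (on_var s (trunc_E_pow N j) F) ls" if "length ls = n" for i j ls
  proof -
    have "on_var t (op_E_pow i) (on_var s (op_E_pow j) F) ls
        = on_var t (op_E_pow i) (on_var s (trunc_E_pow N j) F) ls"
      by (rule on_var_cong[OF _ that]) (rule on_var_op_E_pow[OF assms(1) _ assms(3)])
    also have "\<dots> = on_var t (trunc_E_pow N i) (on_var s (trunc_E_pow N j) F) ls"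
      using on_var_op_E_pow[OF nilpotent_fun_var_ops[OF assms(1) on_var_var_ops[OF trunc_E_pow_delta UNIV_I]]
          that assms(4)] .
    finally show ?thesis .
  qed
  then show ?thesis unfolding pair_op_def trunc_pair_op_def
    by (intro arg_cong2[where f = "(-)"] refl on_var_cong[OF _ assms(2)] on_var_cong) simp_all
qed

lemma pair_op_cong:
  assumes "\<And>ls. length ls = n \<Longrightarrow> F ls = G ls" "length ls = n"
  shows "pair_op S f s t F ls = pair_op S f s t G ls"
proof -
  have "on_var t T (on_var s U F) ls = on_var t T (on_var s U G) ls" if "length ls = n" for T U ls
    by (rule on_var_cong[OF on_var_cong that]) (use assms(1) in auto)
  note 2 = this
  have "Dv s (Dv t (\<lambda>ls. \<Sum>(i, j)\<in>S. const (f (i, j)) * on_var t (op_E_pow i) (on_var s (op_E_pow j) F) ls)) ls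
      = Dv s (Dv t (\<lambda>ls. \<Sum>(i, j)\<in>S. const (f (i, j)) * on_var t (op_E_pow i) (on_var s (op_E_pow j) G) ls)) ls"
    by (rule on_var_cong[OF on_var_cong assms(2)]) (simp_all add: 2)
  then show ?thesis unfolding pair_op_def by (simp add: 2[OF assms(2)])
qed

text \<open>Factors are replaced from the innermost outwards; each one meets a function that is
  nilpotent of order \<open>N\<close>, because truncated factors preserve nilpotency.\<close>

lemma prod_op_eq_trunc:
  assumes "nilpotent_fun N n F" "length ls = n"
  shows "prod_op S f n F ls = trunc_prod S f N n F ls"
proof -
  have "foldr (\<lambda>(s, t) G. pair_op S f s t \<circ> G) ps id F ls
      = foldr (\<lambda>(s, t). trunc_pair_op S f N s t) ps F ls"
    if "set ps \<subseteq> {..<n} \<times> {..<n}" "length ls = n" for ps ls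
    using that
  proof (induction ps arbitrary: ls)
    case (Cons p ps)
    obtain s t where p: "p = (s, t)" by (cases p)
    let ?G = "foldr (\<lambda>(s, t). trunc_pair_op S f N s t) ps F"
    have "pair_op S f s t (foldr (\<lambda>(s, t) G. pair_op S f s t \<circ> G) ps id F) ls = pair_op S f s t ?G ls"
      by (rule pair_op_cong[OF Cons.IH]) (use Cons.prems in auto)
    also have "\<dots> = trunc_pair_op S f N s t ?G ls"
      by (rule pair_op_eq_trunc[OF nilpotent_fun_var_ops[OF assms(1) foldr_pair_var_ops[of _ UNIV]]])
         (use Cons.prems p in auto)
    finally show ?case by (simp add: p comp_def id_def)
  qed simp
  from this[of "pairs n" ls] show ?thesis
    using assms(2) by (simp add: prod_op_def trunc_prod_def pairs_def[symmetric] set_pairs subset_iff)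
qed


section \<open>Determinants of binomials\<close>

lemma indP_power: "indP ^ k = to_fract [:monom 1 k:]"
proof (induction k)
  case (Suc k)
  have "[:[:0, 1:]:] * [:monom 1 k:] = [:monom (1::complex) (Suc k):]" by (simp add: monom_Suc)
  then show ?case using Suc by (simp add: indP_def to_fract_mult del: mult_pCons_left mult_pCons_right) (metis to_fract_mult)
qed (simp add: monom_0 flip: one_pCons)

lemma indP_power_eq_iff: "indP ^ j = indP ^ i \<longleftrightarrow> j = i"
proof
  assume "indP ^ j = indP ^ i"
  then have "monom (1::complex) j = monom 1 i" by (simp add: indP_power)
  then show "j = i" by (metis degree_monom_eq one_neq_zero)
qed simp

text \<open>The numerators share all factors but one, and those two differ by
  \<open>P^(x-r) (1 - P^(r+1))\<close>, whose second factor cancels against the denominator.\<close>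

lemma qbinom_Suc_diff:
  "qbinom (x + 1) (Suc r) - qbinom x (Suc r) = indP powi (x - int r) * qbinom x r"
proof -
  define A where "A = (\<Prod>i<r. 1 - indP powi (x - int i))"
  define D where "D = (\<Prod>i=1..r. 1 - indP ^ i)"
  have 1: "(\<Prod>i<Suc r. 1 - indP powi (x + 1 - int i)) = (1 - indP powi (x + 1)) * A"
    by (subst prod.lessThan_Suc_shift) (simp add: A_def)
  have 2: "indP powi (x + 1) = indP powi (x - int r) * indP ^ Suc r"
    using indP_nonzero by (simp flip: power_int_add power_int_of_nat)
  have 3: "1 - indP ^ Suc r \<noteq> 0"
    using indP_power_eq_iff[of 0 "Suc r"] by auto
  have "qbinom (x + 1) (Suc r) - qbinom x (Suc r)
      = ((1 - indP powi (x + 1)) * A - A * (1 - indP powi (x - int r))) / (D * (1 - indP ^ Suc r))"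
    unfolding qbinom_def 1 by (simp add: A_def D_def diff_divide_distrib)
  also have "(1 - indP powi (x + 1)) * A - A * (1 - indP powi (x - int r))
      = indP powi (x - int r) * A * (1 - indP ^ Suc r)"
    unfolding 2 by (simp add: algebra_simps)
  finally show ?thesis using 3 by (simp add: qbinom_def A_def D_def)
qed

text \<open>The power of \<open>P\<close> is chosen so that the \<open>P\<close>-difference lowers the index without a factor.\<close>

definition nbinom :: "nat \<Rightarrow> int \<Rightarrow> ratPQ" where
  "nbinom r x = indP ^ (r choose 2) * qbinom x r"

lemma nbinom_0: "nbinom 0 x = 1" by (simp add: nbinom_def qbinom_def numeral_2_eq_2)

lemma op_Delta_nbinom: "op_Delta (nbinom (Suc r)) = nbinom r"
proof
  fix x
  have 1: "Suc r choose 2 = r + (r choose 2)" by (simp add: numeral_2_eq_2)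
  have 2: "indP powi (- x) * indP powi (x - int r) * indP ^ r = 1"
    using indP_nonzero by (simp flip: power_int_add power_int_of_nat)
  have "op_Delta (nbinom (Suc r)) x
      = indP ^ (Suc r choose 2) * (indP powi (- x) * (qbinom (x + 1) (Suc r) - qbinom x (Suc r)))"
    by (simp add: op_Delta_def nbinom_def algebra_simps)
  also have "\<dots> = (indP powi (- x) * indP powi (x - int r) * indP ^ r) * nbinom r x"
    unfolding qbinom_Suc_diff 1 nbinom_def by (simp only: power_add mult_ac)
  finally show "op_Delta (nbinom (Suc r)) x = nbinom r x" unfolding 2 by simp
qed

lemma op_Delta_funpow_nbinom:
  assumes "r < N"
  shows "(op_Delta ^^ N) (nbinom r) = (\<lambda>_. 0)"
proof -
  have "(op_Delta ^^ Suc r) (nbinom r) = (\<lambda>_. 0)"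
  proof (induction r)
    case 0
    show ?case by (simp add: op_Delta_def nbinom_0 fun_eq_iff)
  next
    case (Suc r)
    then show ?case by (simp add: funpow_swap1 op_Delta_nbinom)
  qed
  then show ?thesis by (rule op_Delta_funpow_zero_mono) (use assms in simp)
qed

lemma op_Delta_funpow_qbinom:
  assumes "r < N"
  shows "(op_Delta ^^ N) (\<lambda>x. qbinom x r) = (\<lambda>_. 0)"
proof -
  have L: "linear_op (op_Delta ^^ N)"
    by (rule linear_delta_ops[OF op_algebra_funpow]) (auto intro: op_algebra.gen)
  have "(\<lambda>x. qbinom x r) = (\<lambda>x. inverse (indP ^ (r choose 2)) * nbinom r x)"
    using indP_nonzero by (simp add: nbinom_def fun_eq_iff field_simps)
  then show ?thesis by (simp add: linear_op_scale[OF L] op_Delta_funpow_nbinom[OF assms])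
qed

section \<open>Determinants whose rows depend on one variable each\<close>

definition det_fun :: "nat \<Rightarrow> (nat \<Rightarrow> nat \<Rightarrow> int \<Rightarrow> ratPQ) \<Rightarrow> int list \<Rightarrow> ratPQ" where
  "det_fun n G ls = det (mat n n (\<lambda>(i, j). G i j (ls ! i)))"

lemma det_mat_leibniz:
  "det (mat n n (\<lambda>(i, j). g i j))
     = (\<Sum>p | p permutes {0..<n}. signof p * (\<Prod>i = 0..<n. g i (p i)))"
proof -
  have "(\<Prod>i = 0..<n. mat n n (\<lambda>(i, j). g i j) $$ (i, p i)) = (\<Prod>i = 0..<n. g i (p i))"
    if "p permutes {0..<n}" for p
    using that permutes_in_image[OF that] by (intro prod.cong) auto
  then show ?thesis by (subst det_def') auto
qed

lemma det_mat_scale_cols: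
  "det (mat n n (\<lambda>(i, j). c j * g i j)) = (\<Prod>j = 0..<n. c j) * det (mat n n (\<lambda>(i, j). g i j))"
proof -
  have "(\<Prod>i = 0..<n. c (p i)) = (\<Prod>j = 0..<n. c j)" if "p permutes {0..<n}" for p
    using prod.permute[OF that, of c] by (simp add: comp_def)
  then show ?thesis
    by (simp add: det_mat_leibniz prod.distrib sum_distrib_left mult_ac)
qed

lemma Dv_prod:
  assumes "s < n" "length ls = n"
  shows "Dv s (\<lambda>ls. \<Prod>i = 0..<n. g i (ls ! i)) ls = (\<Prod>i = 0..<n. (g(s := op_Delta (g s))) i (ls ! i))"
proof -
  have s: "s \<in> {0..<n}" using assms by simp
  have "(\<Prod>i\<in>{0..<n} - {s}. g i (ls[s := x] ! i)) = (\<Prod>i\<in>{0..<n} - {s}. g i (ls ! i))" for x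
    by (rule prod.cong) auto
  moreover have "(\<Prod>i\<in>{0..<n} - {s}. (g(s := op_Delta (g s))) i (ls ! i)) = (\<Prod>i\<in>{0..<n} - {s}. g i (ls ! i))"
    by (rule prod.cong) auto
  ultimately show ?thesis
    using assms by (simp add: prod.remove[OF _ s] Dv_eq op_Delta_def algebra_simps)
qed

text \<open>Variable \<open>s\<close> occurs in row \<open>s\<close> only. It is for such changes of
  a single row that the entry functions of \<open>det_fun\<close> may depend on the row.\<close>

lemma Dv_det_fun:
  assumes "s < n" "length ls = n"
  shows "Dv s (det_fun n G) ls = det_fun n (G(s := \<lambda>j. op_Delta (G s j))) ls"
proof -
  have "Dv s (det_fun n G) ls = (\<Sum>p | p permutes {0..<n}. signof p *
      Dv s (\<lambda>ls. \<Prod>i = 0..<n. G i (p i) (ls ! i)) ls)"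
    unfolding det_fun_def[abs_def] det_mat_leibniz
    by (simp add: linear_op_sum[OF linear_Dv] linear_op_scale[OF linear_Dv])
  also have "\<dots> = det_fun n (G(s := \<lambda>j. op_Delta (G s j))) ls"
    unfolding det_fun_def det_mat_leibniz
  proof (intro sum.cong refl arg_cong2[where f = "(*)"])
    fix p
    show "Dv s (\<lambda>ls. \<Prod>i = 0..<n. G i (p i) (ls ! i)) ls
        = (\<Prod>i = 0..<n. (G(s := \<lambda>j. op_Delta (G s j))) i (p i) (ls ! i))"
      using Dv_prod[OF assms, of "\<lambda>i. G i (p i)"] by (auto intro: prod.cong)
  qed
  finally show ?thesis .
qed

text \<open>Every Leibniz term contains exactly one entry of row \<open>s\<close>, and the iterated
  difference annihilates it.\<close>

lemma nilpotent_det_fun: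
  assumes "\<And>i j. i < n \<Longrightarrow> j < n \<Longrightarrow> (op_Delta ^^ N) (G i j) = (\<lambda>_. 0)"
  shows "nilpotent_fun N n (det_fun n G)"
  unfolding nilpotent_fun_def
proof (intro allI impI)
  fix ls :: "int list" and s
  assume ls: "length ls = n" and s: "s < n"
  have "(Dv s ^^ k) (det_fun n G) ls = det_fun n (G(s := \<lambda>j. (op_Delta ^^ k) (G s j))) ls"
    if "length ls = n" for k ls
    using that
  proof (induction k arbitrary: ls)
    case (Suc k)
    have "(Dv s ^^ Suc k) (det_fun n G) ls
        = Dv s (det_fun n (G(s := \<lambda>j. (op_Delta ^^ k) (G s j)))) ls"
      unfolding funpow.simps comp_apply by (rule on_var_cong[OF _ Suc.prems]) (rule Suc.IH)
    then show ?case using Dv_det_fun[OF s Suc.prems] by (simp add: fun_upd_def cong: if_cong)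
  qed simp
  then have "(Dv s ^^ N) (det_fun n G) ls = det_fun n (G(s := \<lambda>j. (op_Delta ^^ N) (G s j))) ls"
    using ls .
  also have "\<dots> = 0"
    unfolding det_fun_def det_mat_leibniz
  proof (rule sum.neutral, clarify)
    fix p assume p: "p permutes {0..<n}"
    then have "p s < n" using permutes_in_image[OF p, of s] s by simp
    then have "(G(s := \<lambda>j. (op_Delta ^^ N) (G s j))) s (p s) (ls ! s) = 0" using assms s by simp
    then have "(\<Prod>i = 0..<n. (G(s := \<lambda>j. (op_Delta ^^ N) (G s j))) i (p i) (ls ! i)) = 0"
      using s by (intro prod_zero) auto
    then show "signof p * (\<Prod>i = 0..<n. (G(s := \<lambda>j. (op_Delta ^^ N) (G s j))) i (p i) (ls ! i)) = 0"
      by simp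
  qed
  finally show "(Dv s ^^ N) (det_fun n G) ls = 0" .
qed

text \<open>Used with entries \<open>nbinom (Suc r)\<close>, whose difference is
  \<open>nbinom r\<close>: this supplies the antiderivative that \<open>summation_all_Dv\<close>
  asks for.\<close>

lemma all_Dv_det_fun:
  assumes "length ls = n"
  shows "all_Dv n (det_fun n G) ls = det_fun n (\<lambda>i j. op_Delta (G i j)) ls"
proof -
  have "all_Dv k (det_fun n G) ls = det_fun n (\<lambda>i j. if i < k then op_Delta (G i j) else G i j) ls"
    if "k \<le> n" for k
    using that
  proof (induction k arbitrary: G)
    case (Suc k)
    have "all_Dv (Suc k) (det_fun n G) ls = all_Dv k (det_fun n (G(k := \<lambda>j. op_Delta (G k j)))) ls"
    proof -
      have "all_Dv k (Dv k (det_fun n G)) ls = all_Dv k (det_fun n (G(k := \<lambda>j. op_Delta (G k j)))) ls"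
        by (rule var_ops_cong[OF all_Dv_var_ops _ assms], rule Dv_det_fun) (use Suc.prems in auto)
      then show ?thesis by simp
    qed
    also have "\<dots> = det_fun n (\<lambda>i j. if i < k then op_Delta ((G(k := \<lambda>j. op_Delta (G k j))) i j)
        else (G(k := \<lambda>j. op_Delta (G k j))) i j) ls"
      using Suc.IH Suc.prems by simp
    also have "\<dots> = det_fun n (\<lambda>i j. if i < Suc k then op_Delta (G i j) else G i j) ls"
      by (rule arg_cong[where f = "\<lambda>G. det_fun n G ls"]) (auto simp: fun_eq_iff less_Suc_eq)
    finally show ?case .
  qed simp
  from this[of n] show ?thesis unfolding det_fun_def
    by (auto intro!: arg_cong[where f = det] eq_matI)
qed

lemma det_fun_adj_swap:
  assumes "length ls = n" "Suc i < n"
  shows "det_fun n (\<lambda>_. g) ls = - det_fun n (\<lambda>_. g) (adj_swap i ls)"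
proof -
  let ?A = "\<lambda>ls. mat n n (\<lambda>(i, j). g j (ls ! i))"
  have "?A (adj_swap i ls) = swaprows i (Suc i) (?A ls)"
    using assms by (intro eq_matI) (auto simp: adj_swap_def nth_list_update)
  moreover have "det (swaprows i (Suc i) (?A ls)) = - det (?A ls)"
    using assms by (intro det_swaprows[of _ n]) auto
  ultimately show ?thesis by (simp add: det_fun_def)
qed

section \<open>Induction on the number of variables\<close>

definition binom_idx :: "nat \<Rightarrow> nat \<Rightarrow> nat \<Rightarrow> nat" where
  "binom_idx n m j = j + (if Suc j = n then m else 0)"

text \<open>The first column consists of ones, and deleting it leaves column indices one higher than
  those of size \<open>n\<close>. The bound \<open>1 <= n\<close> keeps \<open>m\<close> out of that
  first column.\<close>

lemma det_nbinom_expand: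
  assumes "length ls = Suc n" "1 \<le> n"
  shows "det_fun (Suc n) (\<lambda>_ j. nbinom (binom_idx (Suc n) m j)) ls
       = (\<Sum>r<Suc n. (- 1) ^ r * det_fun n (\<lambda>_ j. nbinom (Suc (binom_idx n m j))) (drop_nth r ls))"
proof -
  define A where "A = mat (Suc n) (Suc n) (\<lambda>(i, j). nbinom (binom_idx (Suc n) m j) (ls ! i))"
  have "det A = (\<Sum>r<Suc n. A $$ (r, 0) * cofactor A r 0)"
    by (rule laplace_expansion_column[of _ "Suc n"]) (auto simp: A_def)
  also have "\<dots> = (\<Sum>r<Suc n. (- 1) ^ r * det_fun n (\<lambda>_ j. nbinom (Suc (binom_idx n m j))) (drop_nth r ls))"
  proof (rule sum.cong[OF refl])
    fix r assume r: "r \<in> {..<Suc n}"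
    have "A $$ (r, 0) = 1" using r assms by (simp add: A_def binom_idx_def nbinom_0)
    moreover have "mat_delete A r 0 = mat n n (\<lambda>(i, j). nbinom (Suc (binom_idx n m j)) (drop_nth r ls ! i))"
      using r assms by (intro eq_matI) (auto simp: A_def mat_delete_def binom_idx_def nth_drop_nth)
    ultimately show "A $$ (r, 0) * cofactor A r 0
        = (- 1) ^ r * det_fun n (\<lambda>_ j. nbinom (Suc (binom_idx n m j))) (drop_nth r ls)"
      by (simp add: cofactor_def det_fun_def)
  qed
  finally show ?thesis by (simp add: A_def det_fun_def)
qed

text \<open>The factor in \<open>m\<close> undoes the normalisation of \<open>nbinom m\<close> at
  size one, and the step from \<open>n\<close> to \<open>Suc n\<close> divides by the
  \<open>indQ ^ n\<close> of \<open>trunc_prod_del\<close>. One order \<open>N\<close> serves for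
  all sizes up to \<open>n\<close>.\<close>

lemma alpha_eq_trunc_prod:
  assumes "1 \<le> n" "n + m \<le> N" "length ks = n"
  shows "alpha n m S f ks = inverse (indP ^ (m choose 2) * indQ ^ (n choose 2)) *
           trunc_prod S f N n (det_fun n (\<lambda>_ j. nbinom (binom_idx n m j))) ks"
  using assms
proof (induction n arbitrary: ks rule: nat_induct_at_least)
  case base
  then show ?case using indP_nonzero
    by (simp add: trunc_prod_def pairs_def det_fun_def det_single binom_idx_def nbinom_def numeral_2_eq_2 field_simps)
next
  case (Suc n)
  define E where "E = (\<lambda>n. det_fun n (\<lambda>_ j. nbinom (binom_idx n m j)))"
  define B where "B = det_fun n (\<lambda>_ j. nbinom (Suc (binom_idx n m j)))"
  define c where "c = (\<lambda>n. inverse (indP ^ (m choose 2) * indQ ^ (n choose 2)))"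
  have c_Suc: "c (Suc n) = c n * inverse (indQ ^ n)"
    by (simp add: c_def numeral_2_eq_2 power_add)
  note LT = linear_var_ops[OF trunc_prod_var_ops]
  have adm: "admissible S f N n (\<lambda>ls. c n * trunc_prod S f N n B ls)"
  proof (rule admissible_scale, rule admissible_trunc_prod)
    show "nilpotent_fun N n B" unfolding B_def
      by (rule nilpotent_det_fun, rule op_Delta_funpow_nbinom) (use Suc.prems in \<open>auto simp: binom_idx_def\<close>)
    show "B ls = - B (adj_swap i ls)" if "length ls = n" "Suc i < n" for ls i
      unfolding B_def using that by (rule det_fun_adj_swap)
  qed
  have alpha_n: "alpha n m S f ls = all_Dv n (\<lambda>ls. c n * trunc_prod S f N n B ls) ls"
    if ls: "length ls = n" for ls
  proof -
    have "alpha n m S f ls = c n * trunc_prod S f N n (E n) ls"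
      using Suc.IH[OF _ ls] Suc.prems by (simp add: c_def E_def)
    also have "trunc_prod S f N n (E n) ls = trunc_prod S f N n (all_Dv n B) ls"
      by (rule var_ops_cong[OF trunc_prod_var_ops _ ls])
         (simp add: B_def E_def all_Dv_det_fun op_Delta_nbinom)
    also have "trunc_prod S f N n (all_Dv n B) = all_Dv n (trunc_prod S f N n B)"
      by (rule var_ops_commute[OF trunc_prod_var_ops all_Dv_var_ops])
    finally show ?thesis by (simp add: linear_op_scale[OF linear_var_ops[OF all_Dv_var_ops]])
  qed
  have step: "mixed_op r n (trunc_prod S f N n B) (drop_nth r ks)
      = inverse (indQ ^ n) * trunc_prod S f N (Suc n) (\<lambda>ls. B (drop_nth r ls)) ks" if "r \<le> n" for r
  proof -
    have "trunc_prod S f N (Suc n) (\<lambda>ls. B (drop_nth r ls)) ks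
        = indQ ^ n * trunc_prod S f N n (mixed_op r n B) (drop_nth r ks)"
      by (rule trunc_prod_del[OF that Suc.prems(2) refl that order_refl])
    then show ?thesis
      using indQ_nonzero var_ops_commute[OF mixed_op_var_ops[OF that] trunc_prod_var_ops] by simp
  qed
  obtain n' where n': "n = Suc n'" using Suc.hyps by (cases n) auto
  have "alpha (Suc n) m S f ks = summation S f (Suc n) (alpha n m S f) ks"
    by (simp add: n')
  also have "\<dots> = summation S f (Suc n) (all_Dv n (\<lambda>ls. c n * trunc_prod S f N n B ls)) ks"
    by (rule summation_cong) (simp add: alpha_n)
  also have "\<dots> = boundary_sum (Suc n) (\<lambda>ls. c n * trunc_prod S f N n B ls) ks"
    using summation_all_Dv[of S f N "Suc n"] adm by simp
  also have "\<dots> = c n * (\<Sum>r<Suc n. (- 1) ^ r * mixed_op r n (trunc_prod S f N n B) (drop_nth r ks))"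
    using boundary_sum_eq_mixed_op[OF Suc.prems(2)] by (simp add: linear_op_scale[OF linear_boundary_sum])
  also have "\<dots> = c (Suc n) * (\<Sum>r<Suc n. (- 1) ^ r * trunc_prod S f N (Suc n) (\<lambda>ls. B (drop_nth r ls)) ks)"
  proof -
    have "(\<Sum>r<Suc n. (- 1) ^ r * mixed_op r n (trunc_prod S f N n B) (drop_nth r ks))
        = inverse (indQ ^ n) * (\<Sum>r<Suc n. (- 1) ^ r * trunc_prod S f N (Suc n) (\<lambda>ls. B (drop_nth r ls)) ks)"
      unfolding sum_distrib_left by (rule sum.cong) (simp_all add: step)
    then show ?thesis by (simp add: c_Suc)
  qed
  also have "(\<Sum>r<Suc n. (- 1) ^ r * trunc_prod S f N (Suc n) (\<lambda>ls. B (drop_nth r ls)) ks)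
      = trunc_prod S f N (Suc n) (\<lambda>ls. \<Sum>r<Suc n. (- 1) ^ r * B (drop_nth r ls)) ks"
    by (simp only: linear_op_sum[OF LT] linear_op_scale[OF LT])
  also have "\<dots> = trunc_prod S f N (Suc n) (E (Suc n)) ks"
    unfolding E_def B_def
    by (rule var_ops_cong[OF trunc_prod_var_ops _ Suc.prems(2)])
       (rule det_nbinom_expand[symmetric], use Suc.hyps in auto)
  finally show ?case by (simp add: c_def E_def)
qed

lemma binom_det_eq_det_fun: "binom_det n m = det_fun n (\<lambda>_ j x. qbinom x (binom_idx n m j))"
  by (simp add: binom_det_def det_fun_def fun_eq_iff binom_idx_def)

lemma nilpotent_binom_det:
  assumes "n + m \<le> N"
  shows "nilpotent_fun N n (binom_det n m)"
  unfolding binom_det_eq_det_fun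
  by (rule nilpotent_det_fun, rule op_Delta_funpow_qbinom) (use assms in \<open>auto simp: binom_idx_def\<close>)

lemma det_nbinom_eq_binom_det:
  "det_fun n (\<lambda>_ j. nbinom (binom_idx n m j)) =
     (\<lambda>ks. (\<Prod>j = 0..<n. indP ^ (binom_idx n m j choose 2)) * binom_det n m ks)"
  unfolding binom_det_eq_det_fun det_fun_def[abs_def] nbinom_def
  by (simp only: det_mat_scale_cols[of n "\<lambda>j. indP ^ (binom_idx n m j choose 2)"])

section \<open>The exponent of \<open>indP\<close>\<close>

lemma choose_two_int: "2 * int (a choose 2) = int a * (int a - 1)"
  by (induction a) (simp_all add: numeral_2_eq_2 algebra_simps)

lemma sum_choose_two_int: "6 * int (\<Sum>j<k. j choose 2) = int k * (int k - 1) * (int k - 2)"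
proof (induction k)
  case (Suc k)
  then show ?case using choose_two_int[of k] by (simp add: algebra_simps)
qed simp

text \<open>Collects the normalising exponents of all columns, less the one compensated at size one;
  multiplying by 6 avoids reasoning about the integer division.\<close>

lemma binom_idx_exponent:
  assumes "1 \<le> n"
  shows "int (\<Sum>j = 0..<n. binom_idx n m j choose 2) - int (m choose 2)
       = (int n - 1) * (int n ^ 2 - 2 * int n + 6 * int m) div 6"
proof -
  obtain k where n: "n = Suc k" using assms by (cases n) auto
  have "(\<Sum>j = 0..<n. binom_idx n m j choose 2) = (\<Sum>j<k. j choose 2) + (k + m choose 2)"
    unfolding n by (simp add: binom_idx_def atLeast0LessThan)
  moreover have "6 * (int ((\<Sum>j<k. j choose 2) + (k + m choose 2)) - int (m choose 2))
      = (int n - 1) * (int n ^ 2 - 2 * int n + 6 * int m)"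
    using sum_choose_two_int[of k] choose_two_int[of "k + m"] choose_two_int[of m]
    by (simp add: n algebra_simps power2_eq_square)
  ultimately show ?thesis by simp
qed

lemma alpha_eq_prod_op:
  assumes "1 \<le> n" "length ks = n"
  shows "alpha n m S f ks =
           indP powi (((int n - 1) * (int n ^ 2 - 2 * int n + 6 * int m)) div 6)
           * indQ powi (- int (n choose 2)) * prod_op S f n (binom_det n m) ks"
proof -
  let ?N = "n + m"
  have "indP powi (((int n - 1) * (int n ^ 2 - 2 * int n + 6 * int m)) div 6)
      = indP ^ (\<Sum>j = 0..<n. binom_idx n m j choose 2) / indP ^ (m choose 2)"
    unfolding binom_idx_exponent[OF assms(1), symmetric]
    using indP_nonzero by (subst power_int_diff) (simp_all del: of_nat_sum)
  moreover have "alpha n m S f ks = inverse (indP ^ (m choose 2) * indQ ^ (n choose 2)) *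
      (indP ^ (\<Sum>j = 0..<n. binom_idx n m j choose 2) * trunc_prod S f ?N n (binom_det n m) ks)"
    unfolding alpha_eq_trunc_prod[OF assms(1) order_refl assms(2)] det_nbinom_eq_binom_det
    by (simp add: linear_op_scale[OF linear_var_ops[OF trunc_prod_var_ops]] power_sum)
  ultimately show ?thesis
    using prod_op_eq_trunc[OF nilpotent_binom_det[OF order_refl] assms(2), of S f]
    by (simp add: power_int_minus field_simps)
qed

section \<open>The case \<open>m = 0\<close>: a Vandermonde determinant\<close>

definition newton_poly :: "(nat \<Rightarrow> 'a::idom) \<Rightarrow> nat \<Rightarrow> 'a poly" where
  "newton_poly w j = (\<Prod>i<j. [:- w i, 1:])"

lemma newton_poly_monic: "degree (newton_poly w j) = j \<and> coeff (newton_poly w j) j = 1"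
proof (induction j)
  case 0
  show ?case by (simp add: newton_poly_def)
next
  case (Suc j)
  have *: "newton_poly w (Suc j) = newton_poly w j * [:- w j, 1:]" by (simp add: newton_poly_def)
  have "newton_poly w j \<noteq> 0" using Suc by auto
  then have "degree (newton_poly w (Suc j)) = Suc j" unfolding * using Suc by (subst degree_mult_eq) auto
  moreover have "lead_coeff (newton_poly w (Suc j)) = 1"
    unfolding * lead_coeff_mult using Suc by simp
  ultimately show ?case by simp
qed

lemma poly_newton: "poly (newton_poly w j) z = (\<Prod>i<j. z - w i)"
  by (simp add: newton_poly_def poly_prod)

text \<open>Passing from monomials to monic polynomials of the same degrees is multiplication by a
  unitriangular matrix.\<close>

lemma det_monic_polys:
  fixes z :: "nat \<Rightarrow> 'a::idom"
  assumes "\<And>j. degree (p j) = j \<and> coeff (p j) j = 1"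
  shows "det (mat n n (\<lambda>(i, j). poly (p j) (z i))) = det (mat n n (\<lambda>(i, j). z i ^ j))"
proof -
  let ?V = "mat n n (\<lambda>(i, j). z i ^ j)" and ?U = "mat n n (\<lambda>(k, j). coeff (p j) k)"
  have "mat n n (\<lambda>(i, j). poly (p j) (z i)) = ?V * ?U"
  proof (rule eq_matI)
    fix i j assume "i < dim_row (?V * ?U)" "j < dim_col (?V * ?U)"
    then have "i < n" "j < n" by simp_all
    have "poly (p j) (z i) = (\<Sum>k\<le>j. coeff (p j) k * z i ^ k)"
      using assms[of j] by (simp add: poly_altdef)
    also have "\<dots> = (\<Sum>k = 0..<n. coeff (p j) k * z i ^ k)"
      by (rule sum.mono_neutral_left) (use \<open>j < n\<close> assms[of j] in \<open>auto intro: coeff_eq_0\<close>)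
    finally show "mat n n (\<lambda>(i, j). poly (p j) (z i)) $$ (i, j) = (?V * ?U) $$ (i, j)"
      using \<open>i < n\<close> \<open>j < n\<close> by (simp add: scalar_prod_def mult.commute)
  qed simp_all
  moreover have "upper_triangular ?U"
    using assms by (auto simp: upper_triangular_def intro!: coeff_eq_0)
  then have "det ?U = 1"
    using det_upper_triangular[of ?U n] assms by (simp add: prod_list_diag_prod)
  ultimately show ?thesis by (simp add: det_mult[of _ n])
qed

text \<open>
  The determinant does not depend on the nodes \<open>w\<close>, and for the nodes \<open>z\<close> the matrix is triangular.
\<close>

lemma det_newton:
  fixes z :: "nat \<Rightarrow> 'a::idom"
  shows "det (mat n n (\<lambda>(i, j). \<Prod>k<j. z i - w k)) = (\<Prod>j<n. \<Prod>i<j. z j - z i)"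
proof -
  have "det (mat n n (\<lambda>(i, j). \<Prod>k<j. z i - w k)) = det (mat n n (\<lambda>(i, j). \<Prod>k<j. z i - z k))"
    using det_monic_polys[of "newton_poly w" n z, OF newton_poly_monic]
      det_monic_polys[of "newton_poly z" n z, OF newton_poly_monic]
    by (simp add: poly_newton)
  also have "\<dots> = (\<Prod>j<n. \<Prod>i<j. z j - z i)"
    by (subst det_lower_triangular[of n]) (auto simp: prod_list_diag_prod atLeast0LessThan intro!: prod.cong)
  finally show ?thesis .
qed

text \<open>Expanding each fraction by \<open>indP ^ i\<close>, with the denominators taken in
  reverse order, exhibits the binomial as a scaled Newton polynomial in \<open>indP powi x\<close>
  with nodes \<open>indP ^ i\<close>.\<close>

lemma qbinom_eq_prod: "qbinom x j = (\<Prod>i<j. (indP powi x - indP ^ i) / (indP ^ j - indP ^ i))"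
proof -
  have "(\<Prod>i=1..j. 1 - indP ^ i) = (\<Prod>i<j. 1 - indP ^ (j - i))"
    by (rule prod.reindex_bij_witness[of _ "\<lambda>i. j - i" "\<lambda>i. j - i"]) auto
  moreover have "(1 - indP powi (x - int i)) / (1 - indP ^ (j - i))
      = (indP powi x - indP ^ i) / (indP ^ j - indP ^ i)" if "i < j" for i
  proof -
    have "indP ^ i * (1 - indP powi (x - int i)) = indP ^ i - indP powi x"
      using indP_nonzero by (simp add: power_int_diff right_diff_distrib)
    moreover have "indP ^ i * (1 - indP ^ (j - i)) = indP ^ i - indP ^ j"
      using that by (simp add: right_diff_distrib flip: power_add)
    moreover have "(1 - indP powi (x - int i)) / (1 - indP ^ (j - i))
        = (indP ^ i * (1 - indP powi (x - int i))) / (indP ^ i * (1 - indP ^ (j - i)))"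
      using indP_nonzero by simp
    ultimately show ?thesis by (metis minus_diff_eq minus_divide_divide)
  qed
  ultimately show ?thesis by (simp add: qbinom_def flip: prod_dividef)
qed

lemma binom_det_eq_vandermonde_quot:
  "binom_det n 0 ks = indP ^ (n choose 2) * vandermonde_quot n ks"
proof -
  have pow: "(\<Prod>j<n. \<Prod>i<j. indP) = indP ^ (n choose 2)"
    by (induction n) (simp_all add: numeral_2_eq_2 power_add)
  have "binom_det n 0 ks = det (mat n n (\<lambda>(i, j). (\<Prod>k<j. inverse (indP ^ j - indP ^ k)) *
      (\<Prod>k<j. indP powi (ks ! i) - indP ^ k)))"
    by (simp add: binom_det_def qbinom_eq_prod prod.distrib divide_inverse mult.commute)
  also have "\<dots> = (\<Prod>j<n. \<Prod>k<j. inverse (indP ^ j - indP ^ k)) *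
      (\<Prod>j<n. \<Prod>i<j. indP powi (ks ! j) - indP powi (ks ! i))"
    unfolding det_mat_scale_cols[of n "\<lambda>j. \<Prod>k<j. inverse (indP ^ j - indP ^ k)"]
      det_newton[of n "\<lambda>i. indP powi (ks ! i)"] by (simp add: atLeast0LessThan)
  also have "\<dots> = (\<Prod>j<n. \<Prod>i<j. indP * ((indP powi (ks ! j) - indP powi (ks ! i)) / (indP ^ Suc j - indP ^ Suc i)))"
  proof -
    \<comment> \<open>The shifted exponents in \<open>vandermonde_quot\<close> cost one factor
      \<open>indP\<close> for each pair, \<open>indP ^ (n choose 2)\<close> in total.\<close>
    have "inverse (indP ^ j - indP ^ i) = indP / (indP ^ Suc j - indP ^ Suc i)" for i j
      using indP_nonzero by (simp add: divide_inverse flip: right_diff_distrib)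
    then show ?thesis by (simp add: mult.commute flip: prod.distrib)
  qed
  also have "\<dots> = indP ^ (n choose 2) * vandermonde_quot n ks"
    by (simp only: prod.distrib pow vandermonde_quot_def)
  finally show ?thesis .
qed

lemma alpha_zero_eq_prod_op:
  assumes "1 \<le> n" "length ks = n"
  shows "alpha n 0 S f ks =
           indP ^ (Suc n choose 3) * indQ powi (- int (n choose 2)) * prod_op S f n (vandermonde_quot n) ks"
proof -
  let ?V = "\<lambda>ks. inverse (indP ^ (n choose 2)) * binom_det n 0 ks"
  have V: "vandermonde_quot n = ?V"
    using indP_nonzero by (simp add: binom_det_eq_vandermonde_quot fun_eq_iff)
  have nil: "nilpotent_fun n n (binom_det n 0)" by (rule nilpotent_binom_det) simp
  have nilV: "nilpotent_fun n n ?V"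
    using nil by (simp add: nilpotent_fun_def linear_op_scale[OF linear_Dv_funpow])
  \<comment> \<open>\<open>prod_op\<close> may involve the nonlinear \<open>op_E_inv\<close>, so the
    scalar is moved through the truncated product instead.\<close>
  have "prod_op S f n (vandermonde_quot n) ks
      = inverse (indP ^ (n choose 2)) * prod_op S f n (binom_det n 0) ks"
    unfolding V prod_op_eq_trunc[OF nil assms(2)] prod_op_eq_trunc[OF nilV assms(2)]
    by (simp add: linear_op_scale[OF linear_var_ops[OF trunc_prod_var_ops]])
  moreover have "(int n - 1) * (int n ^ 2 - 2 * int n + 6 * int 0) div 6 = int (n choose 3)"
  proof -
    have "(\<Sum>j<n. j choose 2) = n choose 3"
      by (induction n) (simp_all add: numeral_3_eq_3 numeral_2_eq_2)
    then have "6 * int (n choose 3) = (int n - 1) * (int n ^ 2 - 2 * int n + 6 * int 0)"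
      using sum_choose_two_int[of n] by (simp add: algebra_simps power2_eq_square)
    then show ?thesis by simp
  qed
  moreover have "Suc n choose 3 = (n choose 2) + (n choose 3)"
    by (simp add: numeral_3_eq_3 numeral_2_eq_2)
  ultimately show ?thesis
    using alpha_eq_prod_op[OF assms, of 0 S f] indP_nonzero by (simp add: power_add)
qed

theorem theorem3:
  fixes n m :: nat
    and S :: "(int \<times> int) set"
    and f :: "int \<times> int \<Rightarrow> complex"
  assumes "n \<ge> 1"
    and "finite S"
  shows "(\<forall>ks. length ks = n \<longrightarrow>
            alpha n m S f ks =
              indP powi (((int n - 1) * (int n ^ 2 - 2 * int n + 6 * int m)) div 6)
              * indQ powi (- int (n choose 2))
              * prod_op S f n (binom_det n m) ks)
       \<and> (\<forall>ks. length ks = n \<longrightarrow>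
            alpha n 0 S f ks =
              indP ^ (Suc n choose 3)
              * indQ powi (- int (n choose 2))
              * prod_op S f n (vandermonde_quot n) ks)"
  using alpha_eq_prod_op[OF assms(1)] alpha_zero_eq_prod_op[OF assms(1)] by blast

end
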